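(* Let $\lambda_1<\dots<\lambda_n$ be an AP-free spectrum. There exist $C>0$ and $K>0$ such that for every $T_0\in\mathcal{T}_\Lambda$ whose Wilkinson iterates $T_k=\mathbf{W}^k(T_0)$ are defined for all $k$: (a) if $k>K$ then $|(T_{k+1})_{n,n-1}|<1/C$ and $|(T_{k+1})_{n,n-1}|\le C|(T_k)_{n,n-1}|^2$; (b) the set of positive integers $k$ for which $|(T_{k+1})_{n,n-1}|>C|(T_k)_{n,n-1}|^3$ has at most $K$ elements.
   Context: A spectrum is AP-free if no eigenvalue is the average of two others (it contains no 3-term arithmetic progression). $\Lambda=\mathrm{diag}(\lambda_1,\dots,\lambda_n)$ and $\mathcal{T}_\Lambda$ is the set of real symmetric tridiagonal $n\times n$ matrices with spectrum $\{\lambda_1,\dots,\lambda_n\}$. For $T\in\mathcal{T}_\Lambda$, Wilkinson's shift $\omega(T)$ is the eigenvalue of the bottom $2\times 2$ principal block of $T$ closest to $T_{n,n}$ (well defined unless $T_{n,n}=T_{n-1,n-1}$). Wilkinson's step is $\mathbf{W}(T)=Q^*TQ$ where $T-\omega(T)I=QR$, $Q$ orthogonal, $R$ upper triangular with positive diagonal; it is defined when $T_{n,n}\ne T_{n-1,n-1}$ and $\omega(T)$ is not an eigenvalue of $T$, and extended by continuity to matrices with $T_{n,n-1}=0$, $T_{n,n}\neq T_{n-1,n-1}$. *)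

theory Defs
  imports "HOL-Analysis.Analysis"
begin

text \<open>Matrices are n x n real matrices indexed by a finite, well-ordered type 'n,
  whose elements in increasing order play the role of the indices 1,...,n.
  lst is the index n, pen is the index n-1.\<close>

definition lst :: "'n::{finite,wellorder}" where
  "lst = Max UNIV"

definition pen :: "'n::{finite,wellorder}" where
  "pen = Max (UNIV - {lst})"

definition symmetric_mat :: "real^'n::finite^'n \<Rightarrow> bool" where
  "symmetric_mat T \<longleftrightarrow> transpose T = T"

definition tridiagonal :: "real^'n::{finite,wellorder}^'n::{finite,wellorder} \<Rightarrow> bool" where
  "tridiagonal T \<longleftrightarrow>
     (\<forall>i j. T$i$j \<noteq> 0 \<longrightarrow> i = j \<or> (i < j \<and> \<not>(\<exists>k. i < k \<and> k < j))
                                      \<or> (j < i \<and> \<not>(\<exists>k. j < k \<and> k < i)))"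

definition upper_triangular_mat :: "real^'n::{finite,wellorder}^'n::{finite,wellorder} \<Rightarrow> bool" where
  "upper_triangular_mat R \<longleftrightarrow> (\<forall>i j. j < i \<longrightarrow> R$i$j = 0)"

definition is_eigenvalue :: "real^'n::finite^'n \<Rightarrow> real \<Rightarrow> bool" where
  "is_eigenvalue T \<mu> \<longleftrightarrow> (\<exists>v. v \<noteq> 0 \<and> T *v v = \<mu> *\<^sub>R v)"

definition AP_free :: "('n \<Rightarrow> real) \<Rightarrow> bool" where
  "AP_free lam \<longleftrightarrow> \<not> (\<exists>i j k. i \<noteq> j \<and> i \<noteq> k \<and> j \<noteq> k \<and> lam i = (lam j + lam k) / 2)"

definition TLam :: "('n::{finite,wellorder} \<Rightarrow> real) \<Rightarrow> (real^'n::{finite,wellorder}^'n::{finite,wellorder}) set" where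
  "TLam lam = {T. symmetric_mat T \<and> tridiagonal T \<and>
      (\<forall>x. det (mat x - T) = (\<Prod>i\<in>UNIV. x - lam i))}"

text \<open>Wilkinson's shift: the eigenvalue of the bottom 2x2 principal block closest to T_nn.\<close>
definition wshift :: "real^'n::{finite,wellorder}^'n::{finite,wellorder} \<Rightarrow> real" where
  "wshift T = (THE w. (T$pen$pen - w) * (T$lst$lst - w) - T$lst$pen * T$pen$lst = 0 \<and>
      (\<forall>u. (T$pen$pen - u) * (T$lst$lst - u) - T$lst$pen * T$pen$lst = 0 \<longrightarrow>
           \<bar>w - T$lst$lst\<bar> \<le> \<bar>u - T$lst$lst\<bar>))"

definition Wdom :: "('n::{finite,wellorder} \<Rightarrow> real) \<Rightarrow> (real^'n::{finite,wellorder}^'n::{finite,wellorder}) set" where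
  "Wdom lam = {T \<in> TLam lam. T$lst$lst \<noteq> T$pen$pen \<and> \<not> is_eigenvalue T (wshift T)}"

definition W0 :: "real^'n::{finite,wellorder}^'n::{finite,wellorder} \<Rightarrow> real^'n::{finite,wellorder}^'n::{finite,wellorder}" where
  "W0 T = (THE M. \<exists>Q R. orthogonal_matrix Q \<and> upper_triangular_mat R \<and> (\<forall>i. R$i$i > 0) \<and>
             T - mat (wshift T) = Q ** R \<and> M = transpose Q ** T ** Q)"

definition Wdefined :: "('n::{finite,wellorder} \<Rightarrow> real) \<Rightarrow> real^'n::{finite,wellorder}^'n::{finite,wellorder} \<Rightarrow> bool" where
  "Wdefined lam T \<longleftrightarrow> T \<in> Wdom lam \<or>
     (T \<in> TLam lam \<and> T$lst$pen = 0 \<and> T$lst$lst \<noteq> T$pen$pen \<and>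
      at T within Wdom lam \<noteq> bot \<and> (\<exists>M. (W0 \<longlongrightarrow> M) (at T within Wdom lam)))"

definition Wstep :: "('n::{finite,wellorder} \<Rightarrow> real) \<Rightarrow> real^'n::{finite,wellorder}^'n::{finite,wellorder} \<Rightarrow> real^'n::{finite,wellorder}^'n::{finite,wellorder}" where
  "Wstep lam T = (if T \<in> Wdom lam then W0 T else Lim (at T within Wdom lam) W0)"

end

theory Submission
  imports Defs
begin

text \<open>
  Write $a$, $a'$ for the last two diagonal entries of $T$, $b$ for $T_{n,n-1}$, $c$ for
  $T_{n-1,n-2}$ and $w$ for the shift. The last column $q$ of $Q$ satisfies
  $(T - w) q = \rho e_n$ with $\rho = R_{n,n}$, and the new entry obeys
  $|b_1| \le \rho \sin\angle(q, e_n)$. Pairing this equation with $e_n$ and with the null vector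
  $e_n + z e_{n-1}$ of the shifted bottom block gives $\rho^2 \le |b c|/\sqrt 2$, so that
  $b^2 |c|$ shrinks by $1/\sqrt 2$ at each step (Hoffmann and Parlett), while
  $|b_1|^3 \le 2 b^2 |c|$: hence $b$ is uniformly small after a number of steps that depends on
  the spectrum only.

  Once $b$ is small, $w$ is close to one eigenvalue $\lambda_i$, the same from then on, and
  $\sin\angle(q, e_n) = O(b)$. Together with $\rho = O(b)$ this is quadratic convergence, and since
  also $\rho \le |z|\,|c| \sin\angle(q, e_n)$ with $|z| \le |b|/|a - a'|$, a step can fail to be cubic
  only if $a'$ is close to $a \approx \lambda_i$. Then $e_{n-1}$ has two large components
  $j, l \ne i$ in the eigenbasis of $T$, and the last components $x_j$, $x_l$ of the
  corresponding eigenvectors are comparable. But the ratio $x_j/x_l$ is multiplied at every step by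
  $(\lambda_l - w)/(\lambda_j - w)$, whose modulus is bounded away from 1 because the spectrum is
  AP-free; so the ratio is moderate for a bounded number of steps only.
\<close>

section \<open>QR factorisation and Wilkinson's shift\<close>

lemma column_eq_mult_axis: "column j A = A *v axis j (1::real)"
  by (simp add: matrix_vector_mult_basis)

lemma mat_mult_vec: "mat c *v x = c *\<^sub>R (x::real^'n)"
proof -
  have "(if i = j then c else 0) * x $ j = (if i = j then c * x $ i else 0)" for i j
    by simp
  then show ?thesis by (simp add: vec_eq_iff mat_def matrix_vector_mult_def)
qed

text \<open>Gram-Schmidt, one column at a time: \<open>q j\<close> is the normalised part of column
  \<open>j\<close> orthogonal to all earlier columns, and \<open>R\<close> collects the inner
  products \<open>q i \<bullet> column j A\<close>.\<close>

lemma QR_exists: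
  fixes A :: "real^'n::{finite,wellorder}^'n::{finite,wellorder}"
  assumes "invertible A"
  shows "\<exists>Q R. orthogonal_matrix Q \<and> upper_triangular_mat R \<and> (\<forall>i. R$i$i > 0) \<and> A = Q ** R"
proof -
  obtain B where B: "B ** A = mat 1"
    using assms by (auto simp: invertible_def)
  have "\<exists>q. norm q = 1 \<and> q \<in> span {column i A |i. i \<le> j} \<and>
      (\<forall>i<j. q \<bullet> column i A = 0) \<and> q \<bullet> column j A > 0" for j
  proof -
    obtain y z where y: "y \<in> span {column i A |i. i < j}"
      and z: "\<And>w. w \<in> span {column i A |i. i < j} \<Longrightarrow> orthogonal z w"
      and yz: "column j A = y + z"
      using orthogonal_subspace_decomp_exists by blast
    have Bc: "B *v column i A = axis i 1" for i
      by (simp add: column_eq_mult_axis matrix_vector_mul_assoc B)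
    \<comment> \<open>The functional \<open>(B *v v) $ j\<close> of \<open>v\<close> vanishes on the
      earlier columns and is 1 on column \<open>j\<close>, so column \<open>j\<close> is outside
      their span.\<close>
    have "subspace {v. (B *v v) $ j = 0}"
      by (auto simp: subspace_def matrix_vector_right_distrib matrix_vector_mult_scaleR)
    then have "span {column i A |i. i < j} \<subseteq> {v. (B *v v) $ j = 0}"
      by (intro span_minimal) (auto simp: Bc axis_def)
    then have "(B *v y) $ j = 0" using y by auto
    then have "z \<noteq> 0" using yz Bc[of j] by (auto simp: axis_def)
    have zj: "z \<bullet> column j A = norm z ^ 2"
      using z[OF y] by (simp add: yz inner_add_right orthogonal_def power2_norm_eq_inner)
    have "y \<in> span {column i A |i. i \<le> j}"
      using y span_mono[of "{column i A |i. i < j}" "{column i A |i. i \<le> j}"] by force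
    moreover have "column j A \<in> span {column i A |i. i \<le> j}"
      by (rule span_base) auto
    ultimately have "column j A - y \<in> span {column i A |i. i \<le> j}" by (intro span_diff)
    then have zs: "z \<in> span {column i A |i. i \<le> j}" using yz by simp
    have zo: "z \<bullet> column i A = 0" if "i < j" for i
      using z[OF span_base, of "column i A"] that by (auto simp: orthogonal_def)
    show ?thesis
      using \<open>z \<noteq> 0\<close> zj zs zo
      by (intro exI[of _ "z /\<^sub>R norm z"]) (auto intro: span_scale)
  qed
  then have "\<exists>q. \<forall>j. norm (q j) = 1 \<and> q j \<in> span {column i A |i. i \<le> j} \<and>
      (\<forall>i<j. q j \<bullet> column i A = 0) \<and> q j \<bullet> column j A > 0"
    by (intro choice) blast
  then obtain q where q1: "\<And>j. norm (q j) = 1"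
    and qs: "\<And>j. q j \<in> span {column i A |i. i \<le> j}"
    and qo: "\<And>i j. i < j \<Longrightarrow> q j \<bullet> column i A = 0"
    and qp: "\<And>j. q j \<bullet> column j A > 0"
    by blast
  have qq: "q j \<bullet> q i = 0" if "i < j" for i j
  proof -
    have "orthogonal (q j) (q i)"
      by (rule orthogonal_to_span[OF qs[of i]])
         (use qo \<open>i<j\<close> in \<open>auto simp: orthogonal_def dest: order.strict_trans1\<close>)
    then show ?thesis by (simp add: orthogonal_def)
  qed
  define Q where "Q = (\<chi> i j. q j $ i)"
  have colQ: "column j Q = q j" for j by (simp add: Q_def column_def vec_eq_iff)
  have Q: "orthogonal_matrix Q"
    unfolding orthogonal_matrix_orthonormal_columns colQ
    using q1 qq by (metis inner_commute linorder_neqE orthogonal_def)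
  have R: "(transpose Q ** A)$i$j = q i \<bullet> column j A" for i j
    by (simp add: matrix_matrix_mult_def transpose_def Q_def column_def inner_vec_def)
  have "A = Q ** (transpose Q ** A)"
    using Q by (simp add: matrix_mul_assoc orthogonal_matrix_def)
  then show ?thesis
    using Q qo qp by (intro exI[of _ Q] exI[of _ "transpose Q ** A"])
      (auto simp: upper_triangular_mat_def R)
qed

text \<open>Induction over the columns: the entries of \<open>R\<close> above the diagonal are inner
  products with columns of \<open>Q\<close> already known to agree, and what remains is a positive
  multiple of a unit vector, which determines both factors.\<close>

lemma QR_unique:
  fixes Q :: "real^'n::{finite,wellorder}^'n::{finite,wellorder}"
  assumes Q: "orthogonal_matrix Q" "upper_triangular_mat R" "\<forall>i. R$i$i > 0"
    and Q': "orthogonal_matrix Q'" "upper_triangular_mat R'" "\<forall>i. R'$i$i > 0"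
    and eq: "Q ** R = Q' ** R'"
  shows "Q = Q'"
proof -
  have col: "column j (Q ** R) = (\<Sum>i\<in>{..<j}. R$i$j *\<^sub>R column i Q) + R$j$j *\<^sub>R column j Q"
    if "upper_triangular_mat R" for Q R :: "real^'n::{finite,wellorder}^'n::{finite,wellorder}" and j
  proof -
    have "column j (Q ** R) = (\<Sum>i\<in>UNIV. R$i$j *\<^sub>R column i Q)"
      by (simp add: vec_eq_iff column_def matrix_matrix_mult_def mult.commute)
    also have "\<dots> = (\<Sum>i\<in>{..j}. R$i$j *\<^sub>R column i Q)"
      using that by (intro sum.mono_neutral_right) (auto simp: upper_triangular_mat_def)
    also have "{..j} = insert j {..<j}" by auto
    finally show ?thesis by (simp add: add.commute)
  qed
  have coef: "column i Q \<bullet> column j (Q ** R) = R$i$j"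
    if "orthogonal_matrix Q" for Q R :: "real^'n::{finite,wellorder}^'n::{finite,wellorder}" and i j
  proof -
    have "column i Q \<bullet> column j (Q ** R) = (transpose Q ** (Q ** R)) $ i $ j"
      by (simp add: matrix_matrix_mult_def transpose_def column_def inner_vec_def)
    then show ?thesis using that by (simp add: matrix_mul_assoc orthogonal_matrix_def)
  qed
  have "column j Q = column j Q'" for j
  proof (induction j rule: less_induct)
    case (less j)
    have "R$i$j = R'$i$j" if "i < j" for i
      using coef[OF Q(1), of i j R] coef[OF Q'(1), of i j R'] less[OF that] eq by simp
    then have "(\<Sum>i\<in>{..<j}. R$i$j *\<^sub>R column i Q) = (\<Sum>i\<in>{..<j}. R'$i$j *\<^sub>R column i Q')"
      using less by simp
    then have *: "R$j$j *\<^sub>R column j Q = R'$j$j *\<^sub>R column j Q'"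
      using col[OF Q(2), of j Q] col[OF Q'(2), of j Q'] eq by simp
    have "norm (column j Q) = 1" "norm (column j Q') = 1"
      using Q(1) Q'(1) by (auto simp: orthogonal_matrix_orthonormal_columns)
    then have "R$j$j = R'$j$j"
      using arg_cong[OF *, of norm] Q(3) Q'(3) by (simp add: abs_of_pos)
    then show ?case using * Q(3)[rule_format, of j] by simp
  qed
  then show ?thesis by (simp add: vec_eq_iff column_def)
qed

text \<open>Off the spectrum the shifted matrix is invertible, so existence and uniqueness of the
  factorisation give the description in \<open>W0\<close> exactly one value.\<close>

lemma W0_eq:
  assumes "\<not> is_eigenvalue T (wshift T)"
  obtains Q R where "orthogonal_matrix Q" "upper_triangular_mat R" "\<And>i. R$i$i > 0"
    "T - mat (wshift T) = Q ** R" "W0 T = transpose Q ** T ** Q"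
proof -
  have "\<forall>x. (T - mat (wshift T)) *v x = 0 \<longrightarrow> x = 0"
    using assms by (auto simp: is_eigenvalue_def matrix_vector_mult_diff_rdistrib mat_mult_vec)
  then have "invertible (T - mat (wshift T))"
    using matrix_left_invertible_ker invertible_left_inverse by blast
  then obtain Q R where QR: "orthogonal_matrix Q" "upper_triangular_mat R" "\<forall>i. R$i$i > 0"
    "T - mat (wshift T) = Q ** R"
    using QR_exists by blast
  have "W0 T = transpose Q ** T ** Q"
    unfolding W0_def
  proof (rule the_equality)
    show "\<exists>Q' R. orthogonal_matrix Q' \<and> upper_triangular_mat R \<and> (\<forall>i. R$i$i > 0) \<and>
        T - mat (wshift T) = Q' ** R \<and> transpose Q ** T ** Q = transpose Q' ** T ** Q'"
      using QR by blast
  next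
    fix M
    assume "\<exists>Q R. orthogonal_matrix Q \<and> upper_triangular_mat R \<and> (\<forall>i. R$i$i > 0) \<and>
        T - mat (wshift T) = Q ** R \<and> M = transpose Q ** T ** Q"
    then obtain Q' R' where "orthogonal_matrix Q'" "upper_triangular_mat R'" "\<forall>i. R'$i$i > 0"
      "T - mat (wshift T) = Q' ** R'" and M: "M = transpose Q' ** T ** Q'" by blast
    then have "Q = Q'" using QR_unique[OF QR(1-3)] QR(4) by simp
    then show "M = transpose Q ** T ** Q" using M by simp
  qed
  then show thesis using that QR by blast
qed

text \<open>All later estimates see the shift through these two facts. The block has eigenvalues
  \<open>a + (d + s)\<close> and \<open>a + (d - s)\<close>, and \<open>d \<noteq> 0\<close> makes
  one of them strictly nearer to \<open>a\<close>.\<close>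

lemma wshift_props:
  assumes "T$lst$lst \<noteq> T$pen$pen" "T$pen$lst = T$lst$pen"
  shows "(T$pen$pen - wshift T) * (T$lst$lst - wshift T) = (T$lst$pen)\<^sup>2"
    and "\<bar>T$lst$lst - wshift T\<bar> \<le> \<bar>T$pen$pen - wshift T\<bar>"
proof -
  define a c b where "a = T$lst$lst" "c = T$pen$pen" "b = T$lst$pen"
  define d s where "d = (c - a) / 2" "s = sqrt (d\<^sup>2 + b\<^sup>2)"
  define P where "P w \<longleftrightarrow> (c - w) * (a - w) - b * b = 0" for w
  have "d \<noteq> 0" using assms by (simp add: d_s_def a_c_b_def)
  have s2: "s\<^sup>2 = d\<^sup>2 + b\<^sup>2" by (simp add: d_s_def)
  have "s > 0" using \<open>d \<noteq> 0\<close> by (simp add: d_s_def add_pos_nonneg)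
  have P: "P w \<longleftrightarrow> w = a + (d + s) \<or> w = a + (d - s)" for w
  proof -
    have c: "c = a + 2 * d" by (simp add: d_s_def field_simps)
    have "(c - w) * (a - w) - b * b = (w - (a + (d + s))) * (w - (a + (d - s)))"
      using s2 unfolding c by (simp add: algebra_simps power2_eq_square)
    then show ?thesis unfolding P_def by auto
  qed
  \<comment> \<open>The nearer root is the one in which \<open>s\<close> counteracts
    \<open>d\<close>.\<close>
  define w0 where "w0 = (if d > 0 then a + (d - s) else a + (d + s))"
  have min0: "P w0 \<and> (\<forall>u. P u \<longrightarrow> \<bar>w0 - a\<bar> \<le> \<bar>u - a\<bar>)"
    using \<open>s > 0\<close> \<open>d \<noteq> 0\<close> by (auto simp: P w0_def)
  have "wshift T = (THE w. P w \<and> (\<forall>u. P u \<longrightarrow> \<bar>w - a\<bar> \<le> \<bar>u - a\<bar>))"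
    by (simp add: wshift_def P_def a_c_b_def assms)
  also have "\<dots> = w0"
  proof (rule the_equality)
    show "P w0 \<and> (\<forall>u. P u \<longrightarrow> \<bar>w0 - a\<bar> \<le> \<bar>u - a\<bar>)" by (rule min0)
  next
    fix w assume w: "P w \<and> (\<forall>u. P u \<longrightarrow> \<bar>w - a\<bar> \<le> \<bar>u - a\<bar>)"
    then have "\<bar>w - a\<bar> \<le> \<bar>w0 - a\<bar>" using min0 by blast
    with w show "w = w0" using \<open>s > 0\<close> \<open>d \<noteq> 0\<close> by (auto simp: P w0_def split: if_splits)
  qed
  finally have w: "wshift T = w0" .
  show "(T$pen$pen - wshift T) * (T$lst$lst - wshift T) = (T$lst$pen)\<^sup>2"
    using min0 unfolding w P_def by (simp add: a_c_b_def power2_eq_square)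
  have "c = a + 2 * d" by (simp add: d_s_def field_simps)
  then have "\<bar>a - w0\<bar> \<le> \<bar>c - w0\<bar>" using \<open>s > 0\<close> by (auto simp: w0_def)
  then show "\<bar>T$lst$lst - wshift T\<bar> \<le> \<bar>T$pen$pen - wshift T\<bar>"
    unfolding w by (simp add: a_c_b_def)
qed

section \<open>Symmetric tridiagonal matrices and their eigenbases\<close>

lemma le_lst: "i \<le> (lst::'n::{finite,wellorder})"
  by (simp add: lst_def)

lemma le_pen: "i \<noteq> lst \<Longrightarrow> i \<le> (pen::'n::{finite,wellorder})"
  by (simp add: pen_def)

lemma pen_neq_lst:
  assumes "CARD('n::{finite,wellorder}) \<ge> 2"
  shows "(pen::'n) \<noteq> lst"
proof -
  have "UNIV - {lst} \<noteq> ({}::'n set)"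
  proof
    assume "UNIV - {lst} = ({}::'n set)"
    then have "CARD('n) \<le> card {lst::'n}" by (intro card_mono) auto
    with assms show False by simp
  qed
  then show ?thesis using Max_in[of "UNIV - {lst::'n}"] by (auto simp: pen_def)
qed

lemma inner_axis_one [simp]: "x \<bullet> axis i (1::real) = x $ i" "axis i (1::real) \<bullet> x = x $ i"
  by (simp_all add: inner_axis inner_axis')

lemma mult_axis_nth: "(A *v axis j (1::real)) $ i = A $ i $ j"
  by (simp add: matrix_vector_mult_basis column_def)

lemma symmetric_mat_inner:
  assumes "symmetric_mat T"
  shows "(T *v x) \<bullet> y = x \<bullet> (T *v y)"
  by (metis assms dot_lmul_matrix symmetric_mat_def transpose_matrix_vector)

text \<open>In classical indexing this vector is $T_{n-2,n-1} e_{n-2}$; writing it as a residue spares the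
  index $n-2$, and makes it $0$ when $n = 2$.\<close>
definition residue :: "real^'n::{finite,wellorder}^'n::{finite,wellorder} \<Rightarrow> real^'n::{finite,wellorder}" where
  "residue T = T *v axis pen 1 - T$pen$pen *\<^sub>R axis pen 1 - T$lst$pen *\<^sub>R axis lst 1"

lemma TLam_columns:
  fixes T :: "real^'n::{finite,wellorder}^'n::{finite,wellorder}"
  assumes n2: "CARD('n) \<ge> 2" and T: "T \<in> TLam lam"
  shows "T *v axis lst 1 = T$lst$lst *\<^sub>R axis lst 1 + T$lst$pen *\<^sub>R axis pen 1"
    and "T *v axis pen 1 = residue T + T$pen$pen *\<^sub>R axis pen 1 + T$lst$pen *\<^sub>R axis lst 1"
    and "residue T $ lst = 0" and "residue T $ pen = 0"
    and "T$pen$lst = T$lst$pen"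
proof -
  have sym: "T$i$j = T$j$i" for i j
    using T by (auto simp: TLam_def symmetric_mat_def transpose_def vec_eq_iff)
  have pl: "pen \<noteq> (lst::'n)" using pen_neq_lst[OF n2] .
  then have pl': "pen < (lst::'n)" using le_lst[of "pen::'n"] by simp
  have "T$i$lst = 0" if "i \<noteq> lst" "i \<noteq> pen" for i
  proof (rule ccontr)
    assume "T$i$lst \<noteq> 0"
    moreover have "i < pen" using le_pen[OF that(1)] that(2) by simp
    ultimately show False using T pl' that(1) le_lst[of i]
      unfolding TLam_def tridiagonal_def by (auto dest: leD)
  qed
  then show "T *v axis lst 1 = T$lst$lst *\<^sub>R axis lst 1 + T$lst$pen *\<^sub>R axis pen 1"
    using pl sym[of pen lst] by (simp add: vec_eq_iff mult_axis_nth) (auto simp: axis_def)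
  show "T *v axis pen 1 = residue T + T$pen$pen *\<^sub>R axis pen 1 + T$lst$pen *\<^sub>R axis lst 1"
    by (simp add: residue_def)
  show "residue T $ lst = 0" "residue T $ pen = 0"
    using pl by (simp_all add: residue_def mult_axis_nth) (simp_all add: axis_def)
  show "T$pen$lst = T$lst$pen" by (rule sym)
qed

definition eigenbasis :: "real^'n^'n \<Rightarrow> ('n \<Rightarrow> real) \<Rightarrow> ('n \<Rightarrow> real^'n) \<Rightarrow> bool" where
  "eigenbasis T lam v \<longleftrightarrow> (\<forall>i. T *v v i = lam i *\<^sub>R v i) \<and>
     (\<forall>i j. v i \<bullet> v j = (if i = j then 1 else 0))"

lemma TLam_eigenbasis:
  fixes T :: "real^'n::{finite,wellorder}^'n::{finite,wellorder}"
  assumes T: "T \<in> TLam lam" and "inj lam"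
  obtains v where "eigenbasis T lam v"
proof -
  have sym: "symmetric_mat T" using T by (simp add: TLam_def)
  have "\<exists>x. norm x = 1 \<and> T *v x = lam i *\<^sub>R x" for i
  proof -
    have "det (mat (lam i) - T) = (\<Prod>j\<in>UNIV. lam i - lam j)" using T by (simp add: TLam_def)
    then have "det (mat (lam i) - T) = 0" by auto
    then have "\<not> invertible (mat (lam i) - T)" using invertible_det_nz by blast
    then obtain x where x: "(mat (lam i) - T) *v x = 0" "x \<noteq> 0"
      using matrix_left_invertible_ker invertible_left_inverse by blast
    then have "T *v x = lam i *\<^sub>R x" by (simp add: matrix_vector_mult_diff_rdistrib mat_mult_vec)
    then show ?thesis using x(2)
      by (intro exI[of _ "x /\<^sub>R norm x"]) (simp add: matrix_vector_mult_scaleR)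
  qed
  then obtain v where v: "\<And>i. norm (v i) = 1" "\<And>i. T *v v i = lam i *\<^sub>R v i"
    by metis
  have "v i \<bullet> v j = 0" if "i \<noteq> j" for i j
  proof -
    have "lam i * (v i \<bullet> v j) = lam j * (v i \<bullet> v j)"
      using symmetric_mat_inner[OF sym, of "v i" "v j"] by (simp add: v)
    moreover have "lam i \<noteq> lam j" using \<open>inj lam\<close> that by (auto dest: injD)
    ultimately show ?thesis by simp
  qed
  moreover have "v i \<bullet> v i = 1" for i using v(1)[of i] by (simp add: norm_eq_1)
  ultimately have "eigenbasis T lam v" using v(2) by (auto simp: eigenbasis_def)
  then show thesis by (rule that)
qed

text \<open>The matrix whose rows are the eigenvectors is orthogonal, hence preserves inner
  products.\<close>

lemma eigenbasis_parseval:
  fixes v :: "'n::finite \<Rightarrow> real^'n"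
  assumes "eigenbasis T lam v"
  shows "x \<bullet> y = (\<Sum>i\<in>UNIV. (v i \<bullet> x) * (v i \<bullet> y))"
proof -
  define V where "V = (\<chi> i. v i)"
  have "orthogonal_matrix V"
    using assms by (auto simp: orthogonal_matrix_orthonormal_rows row_def V_def eigenbasis_def
        orthogonal_def norm_eq_1)
  then have "(V *v x) \<bullet> (V *v y) = x \<bullet> y"
    by (metis orthogonal_matrix_def dot_lmul_matrix matrix_vector_mul_assoc matrix_vector_mul_lid
        transpose_matrix_vector)
  then show ?thesis by (simp add: matrix_mult_dot V_def inner_vec_def[of "\<chi> i. _ i"])
qed

lemma eigenbasis_norm:
  fixes v :: "'n::finite \<Rightarrow> real^'n"
  assumes "eigenbasis T lam v"
  shows "(norm x)\<^sup>2 = (\<Sum>i\<in>UNIV. (v i \<bullet> x)\<^sup>2)"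
  unfolding power2_norm_eq_inner eigenbasis_parseval[OF assms, of x x] by (simp add: power2_eq_square)

lemma eigenbasis_inner_mult:
  assumes "eigenbasis T lam v" "symmetric_mat T"
  shows "v i \<bullet> (T *v x) = lam i * (v i \<bullet> x)"
  using symmetric_mat_inner[OF assms(2), of "v i" x] assms(1) by (simp add: eigenbasis_def)

lemma bessel2:
  fixes r u q :: "'a::real_inner"
  assumes "norm r = 1" "norm u = 1" "r \<bullet> u = 0"
  shows "(q \<bullet> r)\<^sup>2 + (q \<bullet> u)\<^sup>2 \<le> (norm q)\<^sup>2"
proof -
  have "0 \<le> (norm (q - (q \<bullet> r) *\<^sub>R r - (q \<bullet> u) *\<^sub>R u))\<^sup>2" by simp
  also have "\<dots> = (norm q)\<^sup>2 - (q \<bullet> r)\<^sup>2 - (q \<bullet> u)\<^sup>2"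
    using assms unfolding power2_norm_eq_inner norm_eq_1
    by (simp add: inner_diff_left inner_diff_right inner_commute algebra_simps power2_eq_square)
  finally show ?thesis by simp
qed

text \<open>After normalising \<open>r\<close> and \<open>u\<close>, Bessel bounds the sum of the
  two squared coefficients by 1, and twice their product is at most that sum. Cauchy-Schwarz on each
  factor separately would lose the 2.\<close>

lemma prod_inner_orthogonal_le:
  fixes r u q :: "'a::real_inner"
  assumes "norm q = 1" "r \<bullet> u = 0"
  shows "2 * \<bar>q \<bullet> r\<bar> * \<bar>q \<bullet> u\<bar> \<le> norm r * norm u"
proof (cases "r = 0 \<or> u = 0")
  case False
  define p s where "p = q \<bullet> (r /\<^sub>R norm r)" "s = q \<bullet> (u /\<^sub>R norm u)"
  have "p\<^sup>2 + s\<^sup>2 \<le> 1"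
    using bessel2[of "r /\<^sub>R norm r" "u /\<^sub>R norm u" q] False assms by (simp add: p_s_def)
  moreover have "2 * \<bar>p\<bar> * \<bar>s\<bar> \<le> p\<^sup>2 + s\<^sup>2"
    using sum_squares_bound[of "\<bar>p\<bar>" "\<bar>s\<bar>"] by simp
  ultimately have "2 * \<bar>p\<bar> * \<bar>s\<bar> \<le> 1" by simp
  moreover have "\<bar>q \<bullet> r\<bar> = \<bar>p\<bar> * norm r" "\<bar>q \<bullet> u\<bar> = \<bar>s\<bar> * norm u"
    using False by (simp_all add: p_s_def abs_mult)
  ultimately show ?thesis
    using mult_right_mono[of "2 * \<bar>p\<bar> * \<bar>s\<bar>" 1 "norm r * norm u"] by (simp add: algebra_simps)
qed auto

section \<open>A single step\<close>

locale wilkinson_step =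
  fixes lam :: "'n::{finite,wellorder} \<Rightarrow> real"
    and T :: "real^'n::{finite,wellorder}^'n::{finite,wellorder}"
  assumes n2: "CARD('n) \<ge> 2" and dom: "T \<in> Wdom lam"
begin

abbreviation "e \<equiv> axis (lst::'n) (1::real)"
abbreviation "f \<equiv> axis (pen::'n) (1::real)"
abbreviation "a \<equiv> T$lst$lst"
abbreviation "a' \<equiv> T$pen$pen"
abbreviation "b \<equiv> T$lst$pen"
abbreviation "b1 \<equiv> W0 T$lst$pen"
abbreviation "w \<equiv> wshift T"
abbreviation "r \<equiv> residue T"

lemma T: "T \<in> TLam lam" and aa': "a \<noteq> a'" and not_ev: "\<not> is_eigenvalue T w"
  using dom by (auto simp: Wdom_def)

lemmas cols = TLam_columns[OF n2 T]

lemma sym: "symmetric_mat T" using T by (simp add: TLam_def)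

lemma axes [simp]: "e $ lst = 1" "f $ pen = 1" "e $ pen = 0" "f $ lst = 0"
  using pen_neq_lst[OF n2] by (auto simp: axis_def)

text \<open>By symmetry \<open>T - mat w = transpose R ** transpose Q\<close>, so
  \<open>(T - mat w) ** Q\<close> is the lower triangular \<open>transpose R\<close>, whose last
  column is a multiple of \<open>e\<close>.\<close>

lemma QR_step:
  obtains Q \<rho> where "orthogonal_matrix Q" "\<rho> > 0" "W0 T = transpose Q ** T ** Q"
    "T *v (Q *v e) = w *\<^sub>R (Q *v e) + \<rho> *\<^sub>R e"
proof -
  obtain Q R where QR: "orthogonal_matrix Q" "upper_triangular_mat R" "\<And>i. R$i$i > 0"
    "T - mat w = Q ** R" "W0 T = transpose Q ** T ** Q"
    using W0_eq[OF not_ev] by blast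
  have "transpose (T - mat w) = T - mat w"
    using sym by (auto simp: symmetric_mat_def transpose_def vec_eq_iff mat_def)
  then have "T - mat w = transpose R ** transpose Q"
    using QR(4) matrix_transpose_mul by metis
  then have "(T - mat w) ** Q = transpose R"
    using QR(1) by (simp add: matrix_mul_assoc[symmetric] orthogonal_matrix_def)
  then have "(T - mat w) *v (Q *v e) = transpose R *v e"
    by (simp add: matrix_vector_mul_assoc)
  also have "\<dots> = R$lst$lst *\<^sub>R e"
  proof -
    have "R$lst$i = 0" if "i \<noteq> lst" for i
      using QR(2) that le_lst[of i] by (auto simp: upper_triangular_mat_def)
    then show ?thesis
      by (simp add: vec_eq_iff mult_axis_nth transpose_def del: transpose_matrix_vector) (auto simp: axis_def)
  qed
  finally have "T *v (Q *v e) = w *\<^sub>R (Q *v e) + R$lst$lst *\<^sub>R e"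
    by (simp add: matrix_vector_mult_diff_rdistrib mat_mult_vec algebra_simps)
  then show thesis using that QR by blast
qed

definition "Q = (SOME Q. \<exists>\<rho>. orthogonal_matrix Q \<and> \<rho> > 0 \<and> W0 T = transpose Q ** T ** Q \<and>
    T *v (Q *v e) = w *\<^sub>R (Q *v e) + \<rho> *\<^sub>R e)"
definition "\<rho> = (SOME \<rho>. orthogonal_matrix Q \<and> \<rho> > 0 \<and> W0 T = transpose Q ** T ** Q \<and>
    T *v (Q *v e) = w *\<^sub>R (Q *v e) + \<rho> *\<^sub>R e)"
definition "q = Q *v e"
text \<open>\<open>\<rho>\<close> is $R_{n,n}$, \<open>q\<close> the last column of \<open>Q\<close>, \<open>u\<close> is $(T - w)e_n$, and \<open>S2\<close> below is the squared sine
  of the angle between \<open>q\<close> and $e_n$.\<close>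
definition "u = (a - w) *\<^sub>R e + b *\<^sub>R f"

lemma Q: "orthogonal_matrix Q" and \<rho>: "\<rho> > 0" and W0: "W0 T = transpose Q ** T ** Q"
  and Tq: "T *v q = w *\<^sub>R q + \<rho> *\<^sub>R e"
proof -
  have "\<exists>Q \<rho>. orthogonal_matrix Q \<and> \<rho> > 0 \<and> W0 T = transpose Q ** T ** Q \<and>
      T *v (Q *v e) = w *\<^sub>R (Q *v e) + \<rho> *\<^sub>R e"
    using QR_step by blast
  from someI_ex[OF this, folded Q_def]
  have "\<exists>\<rho>. orthogonal_matrix Q \<and> \<rho> > 0 \<and> W0 T = transpose Q ** T ** Q \<and>
      T *v (Q *v e) = w *\<^sub>R (Q *v e) + \<rho> *\<^sub>R e" .
  from someI_ex[OF this, folded \<rho>_def]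
  show "orthogonal_matrix Q" "\<rho> > 0" "W0 T = transpose Q ** T ** Q" "T *v q = w *\<^sub>R q + \<rho> *\<^sub>R e"
    by (auto simp: q_def)
qed

section \<open>The isometry \<open>Q\<close> and the corner of the next matrix\<close>

lemma Q_inner: "(Q *v x) \<bullet> y = x \<bullet> (transpose Q *v y)"
  by (metis dot_lmul_matrix inner_commute transpose_matrix_vector)

lemma Q_isometry: "(Q *v x) \<bullet> (Q *v y) = x \<bullet> y"
  by (metis Q Q_inner matrix_vector_mul_assoc matrix_vector_mul_lid orthogonal_matrix_def)

lemma Q_norm: "norm (Q *v x) = norm x"
  by (simp add: norm_eq_sqrt_inner Q_isometry)

lemma Qt_norm: "norm (transpose Q *v x) = norm x"
  by (metis Q Q_norm matrix_vector_mul_assoc matrix_vector_mul_lid orthogonal_matrix_def)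

lemma W0_mult: "W0 T *v x = transpose Q *v (T *v (Q *v x))"
  by (simp add: W0 matrix_vector_mul_assoc matrix_mul_assoc del: transpose_matrix_vector)

lemma Q_W0: "Q *v (W0 T *v x) = T *v (Q *v x)"
  using Q by (simp add: W0 matrix_vector_mul_assoc matrix_mul_assoc orthogonal_matrix_def)

lemma norm_q: "norm q = 1" by (simp add: q_def Q_norm)

text \<open>Apply \<open>transpose Q\<close> to the equation \<open>Tq\<close>. Both new corner
  entries are read off from this column.\<close>

lemma W0_lst: "W0 T *v e = w *\<^sub>R e + \<rho> *\<^sub>R (transpose Q *v e)"
proof -
  have "transpose Q *v (Q *v e) = e"
    using Q by (metis matrix_vector_mul_assoc matrix_vector_mul_lid orthogonal_matrix_def)
  then show ?thesis
    by (simp add: W0_mult Tq[unfolded q_def] matrix_vector_right_distrib matrix_vector_mult_scaleR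
        del: transpose_matrix_vector)
qed

lemma next_diag: "W0 T$lst$lst = w + \<rho> * (e \<bullet> q)"
proof -
  have "W0 T$lst$lst = (W0 T *v e) \<bullet> e" by (simp add: mult_axis_nth)
  also have "\<dots> = w + \<rho> * ((transpose Q *v e) \<bullet> e)"
    unfolding W0_lst by (simp add: inner_add_left del: transpose_matrix_vector)
  also have "(transpose Q *v e) \<bullet> e = e \<bullet> q"
    using Q_inner[of e e] by (simp add: q_def inner_commute del: transpose_matrix_vector)
  finally show ?thesis .
qed

lemma next_sub: "b1 = \<rho> * ((transpose Q *v e) \<bullet> f)"
proof -
  have "symmetric_mat (W0 T)"
    using sym by (simp add: symmetric_mat_def W0 matrix_transpose_mul matrix_mul_assoc)
  then have "W0 T$pen$lst = b1" by (simp add: symmetric_mat_def transpose_def vec_eq_iff)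
  then have "b1 = (W0 T *v e) \<bullet> f" by (simp add: mult_axis_nth)
  also have "\<dots> = \<rho> * ((transpose Q *v e) \<bullet> f)"
    unfolding W0_lst by (simp add: inner_add_left del: transpose_matrix_vector)
  finally show ?thesis .
qed

definition "S2 = 1 - (e \<bullet> q)\<^sup>2"

lemma S2_nonneg: "0 \<le> S2" and S2_le: "S2 \<le> 1"
proof -
  have "\<bar>e \<bullet> q\<bar> \<le> norm e * norm q" by (rule Cauchy_Schwarz_ineq2)
  then have "\<bar>e \<bullet> q\<bar> \<le> 1" by (simp add: norm_q)
  then show "0 \<le> S2" by (simp add: S2_def abs_square_le_1)
qed (simp add: S2_def)

text \<open>\<open>transpose Q *v e\<close> is a unit vector whose component along \<open>e\<close>
  is the cosine \<open>e \<bullet> q\<close>, so its component along \<open>f\<close> is at most the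
  sine.\<close>

lemma next_sub_le: "\<bar>b1\<bar> \<le> \<rho> * sqrt S2"
proof -
  have "((transpose Q *v e) \<bullet> e)\<^sup>2 + ((transpose Q *v e) \<bullet> f)\<^sup>2 \<le> (norm (transpose Q *v e))\<^sup>2"
    by (rule bessel2) simp_all
  moreover have "(transpose Q *v e) \<bullet> e = e \<bullet> q"
    using Q_inner[of e e] by (simp add: q_def inner_commute del: transpose_matrix_vector)
  ultimately have "((transpose Q *v e) \<bullet> f)\<^sup>2 \<le> S2"
    by (simp only: Qt_norm S2_def) simp
  then have "\<bar>(transpose Q *v e) \<bullet> f\<bar> \<le> sqrt S2" by (simp add: real_le_rsqrt abs_le_iff real_sqrt_abs2 flip: real_sqrt_abs)
  then show ?thesis using \<rho> by (simp add: next_sub abs_mult)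
qed

lemma next_sub_le_\<rho>: "\<bar>b1\<bar> \<le> \<rho>"
proof -
  have "\<rho> * sqrt S2 \<le> \<rho> * 1" using S2_le \<rho> by (intro mult_left_mono) auto
  then show ?thesis using next_sub_le by simp
qed

text \<open>\<open>Q\<close> carries the vector \<open>y\<close> to (T - a)(T - w)q, which is
  \<open>\<rho> * b\<close> times \<open>f\<close>; hence the norm of \<open>y\<close>. In the
  coordinates of the new matrix, the only way from \<open>e\<close> to the new residue is through
  \<open>f\<close>, at the price \<open>b1\<close>, so pairing \<open>y\<close> with that residue
  isolates the left side.\<close>

lemma next_residue_le:
  assumes "W0 T \<in> TLam lam"
  shows "\<bar>b1\<bar> * norm (residue (W0 T)) \<le> \<rho> * \<bar>b\<bar>"
proof -
  note cols1 = TLam_columns[OF n2 assms]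
  let ?T1 = "W0 T" and ?r1 = "residue (W0 T)"
  define y where "y = ?T1 *v (?T1 *v e - w *\<^sub>R e) - a *\<^sub>R (?T1 *v e - w *\<^sub>R e)"
  have "Q *v (?T1 *v e - w *\<^sub>R e) = \<rho> *\<^sub>R e"
    by (simp add: matrix_vector_mult_diff_distrib Q_W0 matrix_vector_mult_scaleR
        Tq[unfolded q_def])
  then have "Q *v y = \<rho> *\<^sub>R (b *\<^sub>R f)"
    by (simp add: y_def matrix_vector_mult_diff_distrib Q_W0 matrix_vector_mult_scaleR cols(1) algebra_simps)
  then have ny: "norm y = \<rho> * \<bar>b\<bar>"
    using Q_norm[of y] \<rho> by (simp add: abs_mult)
  have "?r1 \<bullet> y = b1 * (norm ?r1)\<^sup>2"
    by (simp add: y_def cols1 matrix_vector_mult_diff_distrib matrix_vector_right_distrib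
        matrix_vector_mult_scaleR inner_diff_right inner_add_right power2_norm_eq_inner)
  moreover have "\<bar>?r1 \<bullet> y\<bar> \<le> norm ?r1 * norm y" by (rule Cauchy_Schwarz_ineq2)
  ultimately have "norm ?r1 * (\<bar>b1\<bar> * norm ?r1) \<le> norm ?r1 * norm y"
    by (simp add: abs_mult power2_eq_square algebra_simps)
  then show ?thesis using ny \<rho> by (cases "?r1 = 0") auto
qed

section \<open>Estimates for the shift, for \<open>\<rho>\<close> and for the potential\<close>

lemma shift: "(a' - w) * (a - w) = b\<^sup>2" "\<bar>a - w\<bar> \<le> \<bar>a' - w\<bar>"
  using wshift_props[OF aa' cols(5)] by auto

text \<open>If \<open>b\<close> were 0, the shift would be \<open>a\<close>, an eigenvalue with
  eigenvector \<open>e\<close>. Deflated matrices are therefore reached only by the continuous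
  extension.\<close>

lemma b_nonzero: "b \<noteq> 0"
proof
  assume b: "b = 0"
  then have "a = w" using shift by auto
  then have "T *v e = w *\<^sub>R e" using cols(1) b by simp
  then show False using not_ev unfolding is_eigenvalue_def by (metis axis_eq_0_iff zero_neq_one)
qed

text \<open>It is the smaller of two factors whose product is \<open>b\<^sup>2\<close>.\<close>

lemma shift_diag: "\<bar>a - w\<bar> \<le> \<bar>b\<bar>"
proof -
  have "\<bar>a - w\<bar> * \<bar>a - w\<bar> \<le> \<bar>a' - w\<bar> * \<bar>a - w\<bar>" using shift(2) by (intro mult_right_mono) auto
  also have "\<dots> = b\<^sup>2" using shift(1) by (metis abs_mult abs_power2)
  finally show ?thesis by (simp add: power2_eq_square abs_le_square_iff)
qed

text \<open>The kernel of the bottom block of $T - w$ is spanned by $e_n + z e_{n-1}$.\<close>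
definition "z = - (a - w) / b"

lemma zb: "z * b = - (a - w)" using b_nonzero by (simp add: z_def)

lemma z_le_1: "\<bar>z\<bar> \<le> 1"
  using shift_diag b_nonzero by (simp add: z_def field_simps)

lemma bz: "b + z * (a' - w) = 0"
proof -
  have "b * (b + z * (a' - w)) = b\<^sup>2 + (z * b) * (a' - w)"
    by (simp add: algebra_simps power2_eq_square)
  also have "\<dots> = 0" unfolding zb using shift(1) by (simp add: algebra_simps)
  finally show ?thesis using b_nonzero by simp
qed

text \<open>\<open>a - w\<close> and \<open>a' - w\<close> do not have opposite signs and the first
  is the smaller in modulus, so \<open>a\<close> lies between \<open>w\<close> and
  \<open>a'\<close>; and \<open>bz\<close> gives
  \<open>\<bar>z\<bar> * \<bar>a' - w\<bar> = \<bar>b\<bar>\<close>.\<close>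

lemma z_gap: "\<bar>z\<bar> * \<bar>a - a'\<bar> \<le> \<bar>b\<bar>"
proof -
  have "0 \<le> (a' - w) * (a - w)" using shift(1) by simp
  then have "\<bar>a - a'\<bar> \<le> \<bar>a' - w\<bar>"
    using shift(2) by (auto simp: zero_le_mult_iff)
  then have "\<bar>z\<bar> * \<bar>a - a'\<bar> \<le> \<bar>z\<bar> * \<bar>a' - w\<bar>" by (intro mult_left_mono) auto
  also have "\<dots> = \<bar>b\<bar>" using bz by (metis abs_minus_cancel abs_mult add_eq_0_iff)
  finally show ?thesis .
qed

text \<open>The equation \<open>Tq\<close> paired with a test vector \<open>x\<close>, with
  \<open>T\<close> moved over by symmetry. Testing with \<open>e\<close> and with the kernel vector
  of the block yields two different expressions for \<open>\<rho>\<close>.\<close>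

lemma \<rho>_inner:
  assumes "T *v x - w *\<^sub>R x = y"
  shows "\<rho> * (x \<bullet> e) = q \<bullet> y"
proof -
  have "q \<bullet> y = (T *v q) \<bullet> x - w * (q \<bullet> x)"
    by (simp add: assms[symmetric] inner_diff_right symmetric_mat_inner[OF sym])
  also have "\<dots> = \<rho> * (x \<bullet> e)" unfolding Tq by (simp add: inner_add_left)
  finally show ?thesis by simp
qed

lemma Tu: "T *v e - w *\<^sub>R e = u"
  by (simp add: cols(1) u_def algebra_simps)

lemma \<rho>_u: "\<rho> = q \<bullet> u"
  using \<rho>_inner[OF Tu] by simp

lemma \<rho>_r: "\<rho> = z * (q \<bullet> r)"
proof -
  have "T *v (e + z *\<^sub>R f) - w *\<^sub>R (e + z *\<^sub>R f) = z *\<^sub>R r + (a - w + z * b) *\<^sub>R e + (b + z * (a' - w)) *\<^sub>R f"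
    by (simp add: matrix_vector_right_distrib matrix_vector_mult_scaleR cols(1,2) algebra_simps)
  then have "T *v (e + z *\<^sub>R f) - w *\<^sub>R (e + z *\<^sub>R f) = z *\<^sub>R r"
    using zb bz by simp
  from \<rho>_inner[OF this] show ?thesis by simp
qed

lemma norm_u: "(norm u)\<^sup>2 \<le> 2 * b\<^sup>2"
proof -
  have "(norm u)\<^sup>2 = (a - w)\<^sup>2 + b\<^sup>2"
    unfolding power2_norm_eq_inner by (simp add: u_def inner_add_left inner_add_right power2_eq_square)
  moreover have "(a - w)\<^sup>2 \<le> b\<^sup>2" using shift_diag by (simp add: abs_le_square_iff)
  ultimately show ?thesis by simp
qed

lemma norm_u_le: "norm u \<le> sqrt 2 * \<bar>b\<bar>"
  using norm_u by (metis norm_ge_zero real_le_rsqrt real_sqrt_abs real_sqrt_mult)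

lemma \<rho>_le_b: "\<rho> \<le> sqrt 2 * \<bar>b\<bar>"
  using Cauchy_Schwarz_ineq2[of q u] norm_u_le \<rho>_u norm_q by simp

lemma \<rho>_le_residue: "\<rho> \<le> norm r"
proof -
  have "\<rho> \<le> \<bar>z\<bar> * \<bar>q \<bullet> r\<bar>" using \<rho>_r by (metis abs_ge_self abs_mult)
  also have "\<dots> \<le> 1 * (norm q * norm r)"
    using z_le_1 Cauchy_Schwarz_ineq2[of q r] by (intro mult_mono) auto
  finally show ?thesis by (simp add: norm_q)
qed

text \<open>\<open>\<rho>\<close> is both $\langle q, u\rangle$ and $z\langle q, r\rangle$. Since \<open>u\<close> and \<open>r\<close> are orthogonal and \<open>q\<close>
  is a unit vector, the product of the two gains a factor $1/2$, without which the potential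
  $b^2 \|r\|$ need not decrease.\<close>
lemma \<rho>_square: "\<rho>\<^sup>2 \<le> sqrt 2 / 2 * \<bar>b\<bar> * norm r"
proof -
  have "\<rho>\<^sup>2 = \<bar>z\<bar> * (\<bar>q \<bullet> r\<bar> * \<bar>q \<bullet> u\<bar>)"
    using \<rho>_r \<rho>_u \<rho> by (metis abs_mult abs_of_pos mult.assoc power2_eq_square)
  also have "\<dots> \<le> 1 * (norm r * norm u / 2)"
  proof (rule mult_mono)
    have "r \<bullet> u = 0" using cols by (simp add: u_def inner_add_right)
    then show "\<bar>q \<bullet> r\<bar> * \<bar>q \<bullet> u\<bar> \<le> norm r * norm u / 2"
      using prod_inner_orthogonal_le[OF norm_q, of r u] by simp
  qed (use z_le_1 in auto)
  also have "\<dots> \<le> norm r * (sqrt 2 * \<bar>b\<bar>) / 2"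
    using norm_u_le by (simp add: mult_left_mono)
  finally show ?thesis by (simp add: algebra_simps)
qed

text \<open>Of three factors \<open>\<rho>\<close>, two are bounded through \<open>b\<close> and one
  through \<open>r\<close>. This reproduces the weights of the potential, so decay of the potential
  forces decay of the corner entry.\<close>

lemma next_cube: "\<bar>b1\<bar> ^ 3 \<le> 2 * (b\<^sup>2 * norm r)"
proof -
  have "\<bar>b1\<bar> ^ 3 \<le> \<rho> ^ 3" using next_sub_le_\<rho> by (intro power_mono) auto
  also have "\<dots> = \<rho>\<^sup>2 * \<rho>" by (simp add: power3_eq_cube power2_eq_square)
  also have "\<dots> \<le> (sqrt 2 * \<bar>b\<bar>)\<^sup>2 * norm r"
    using \<rho> \<rho>_le_b \<rho>_le_residue by (intro mult_mono power_mono) auto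
  finally show ?thesis by (simp add: power_mult_distrib)
qed

text \<open>One factor \<open>b1\<close> is at most \<open>\<rho>\<close>, the other combines with
  the new residue to at most \<open>\<rho> * \<bar>b\<bar>\<close>; then
  \<open>\<rho>_square\<close> supplies the contraction factor.\<close>

lemma next_potential:
  assumes "W0 T \<in> TLam lam"
  shows "b1\<^sup>2 * norm (residue (W0 T)) \<le> sqrt 2 / 2 * (b\<^sup>2 * norm r)"
proof -
  have "b1\<^sup>2 * norm (residue (W0 T)) = \<bar>b1\<bar> * (\<bar>b1\<bar> * norm (residue (W0 T)))"
    by (simp add: power2_eq_square)
  also have "\<dots> \<le> \<rho> * (\<rho> * \<bar>b\<bar>)"
    by (rule mult_mono[OF next_sub_le_\<rho> next_residue_le[OF assms]]) (use \<rho> in auto)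
  also have "\<dots> = \<rho>\<^sup>2 * \<bar>b\<bar>" by (simp add: power2_eq_square)
  also have "\<dots> \<le> sqrt 2 / 2 * \<bar>b\<bar> * norm r * \<bar>b\<bar>"
    using \<rho>_square by (intro mult_right_mono) auto
  finally show ?thesis by (simp add: power2_eq_square algebra_simps)
qed

text \<open>\<open>r\<close> is orthogonal to \<open>e\<close>, so only the part of \<open>q\<close>
  orthogonal to \<open>e\<close>, of length \<open>sqrt S2\<close>, enters \<open>\<rho>_r\<close>.
  The second \<open>sqrt S2\<close> comes from \<open>next_sub_le\<close>, the factor
  \<open>\<bar>b\<bar>\<close> from \<open>z_gap\<close>.\<close>

lemma next_sub_gap: "\<bar>b1\<bar> * \<bar>a - a'\<bar> \<le> \<bar>b\<bar> * norm r * S2"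
proof -
  have "\<bar>q \<bullet> r\<bar> \<le> norm (q - (e \<bullet> q) *\<^sub>R e) * norm r"
    using Cauchy_Schwarz_ineq2[of "q - (e \<bullet> q) *\<^sub>R e" r] cols by (simp add: inner_diff_left)
  also have "norm (q - (e \<bullet> q) *\<^sub>R e) = sqrt S2"
  proof -
    have "(q - (e \<bullet> q) *\<^sub>R e) \<bullet> (q - (e \<bullet> q) *\<^sub>R e) = S2"
      using norm_q unfolding norm_eq_1 S2_def
      by (simp add: inner_diff_left inner_diff_right power2_eq_square)
    then show ?thesis by (simp add: norm_eq_sqrt_inner)
  qed
  finally have qr: "\<bar>q \<bullet> r\<bar> \<le> sqrt S2 * norm r" .
  have "\<rho> * \<bar>a - a'\<bar> = (\<bar>z\<bar> * \<bar>a - a'\<bar>) * \<bar>q \<bullet> r\<bar>"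
  proof -
    have "\<rho> = \<bar>z\<bar> * \<bar>q \<bullet> r\<bar>" using \<rho>_r \<rho> by (metis abs_mult abs_of_pos)
    then show ?thesis by (simp add: mult_ac)
  qed
  also have "\<dots> \<le> \<bar>b\<bar> * (sqrt S2 * norm r)"
    using z_gap qr by (intro mult_mono) auto
  finally have "sqrt S2 * (\<rho> * \<bar>a - a'\<bar>) \<le> sqrt S2 * (\<bar>b\<bar> * (sqrt S2 * norm r))"
    using S2_nonneg by (intro mult_left_mono) auto
  also have "\<dots> = (sqrt S2 * sqrt S2) * (\<bar>b\<bar> * norm r)" by (simp only: mult_ac)
  also have "\<dots> = \<bar>b\<bar> * norm r * S2" using S2_nonneg by simp
  finally have "(\<rho> * sqrt S2) * \<bar>a - a'\<bar> \<le> \<bar>b\<bar> * norm r * S2" by (simp add: mult_ac)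
  moreover have "\<bar>b1\<bar> * \<bar>a - a'\<bar> \<le> (\<rho> * sqrt S2) * \<bar>a - a'\<bar>"
    using next_sub_le by (intro mult_right_mono) auto
  ultimately show ?thesis by simp
qed

end

section \<open>One step in eigenvector coordinates\<close>

context wilkinson_step
begin

lemma lam_neq_shift:
  assumes "eigenbasis T lam v"
  shows "lam j \<noteq> w"
proof
  assume "lam j = w"
  moreover have "v j \<noteq> 0" using assms by (metis eigenbasis_def inner_zero_left zero_neq_one)
  ultimately show False using not_ev assms by (auto simp: is_eigenvalue_def eigenbasis_def)
qed

lemma coord_u:
  assumes "eigenbasis T lam v"
  shows "(lam j - w) * v j $ lst = v j \<bullet> u"
  using eigenbasis_inner_mult[OF assms sym, of j e]
  by (simp add: Tu[symmetric] inner_diff_right algebra_simps)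

lemma coord_q:
  assumes "eigenbasis T lam v"
  shows "(lam j - w) * (v j \<bullet> q) = \<rho> * v j $ lst"
  using eigenbasis_inner_mult[OF assms sym, of j q]
  unfolding Tq by (simp add: inner_add_right algebra_simps)

lemma coord_pen:
  assumes "eigenbasis T lam v"
  shows "b * v j $ pen = (lam j - a) * v j $ lst"
  using eigenbasis_inner_mult[OF assms sym, of j e]
  unfolding cols(1) by (simp add: inner_add_right algebra_simps)

lemma sum_lst:
  assumes "eigenbasis T lam v"
  shows "(\<Sum>j\<in>UNIV. (v j $ lst)\<^sup>2) = 1"
  using eigenbasis_norm[OF assms, of e] by simp

text \<open>The unit vector \<open>e\<close> satisfies (T - w)e = u with norm at most
  \<open>sqrt 2 * \<bar>b\<bar>\<close>, whereas \<open>T - w\<close> stretches every vector by at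
  least the distance from \<open>w\<close> to the spectrum.\<close>

lemma ex_near_shift:
  assumes v: "eigenbasis T lam v"
  shows "\<exists>i. \<bar>lam i - w\<bar> \<le> sqrt 2 * \<bar>b\<bar>"
proof (rule ccontr)
  assume "\<not> ?thesis"
  then have far: "sqrt 2 * \<bar>b\<bar> < \<bar>lam j - w\<bar>" for j by (meson not_le)
  have far2: "2 * b\<^sup>2 < (lam j - w)\<^sup>2" for j
    using power_strict_mono[OF far[of j], of 2] by (simp add: power_mult_distrib)
  have "(\<Sum>j\<in>UNIV. 2 * b\<^sup>2 * (v j $ lst)\<^sup>2) < (\<Sum>j\<in>UNIV. (lam j - w)\<^sup>2 * (v j $ lst)\<^sup>2)"
  proof (rule sum_strict_mono_ex1)
    show "\<forall>j\<in>UNIV. 2 * b\<^sup>2 * (v j $ lst)\<^sup>2 \<le> (lam j - w)\<^sup>2 * (v j $ lst)\<^sup>2"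
      using mult_right_mono[OF less_imp_le[OF far2]] by simp
    obtain j where "v j $ lst \<noteq> 0" using sum_lst[OF v] by fastforce
    then have "2 * b\<^sup>2 * (v j $ lst)\<^sup>2 < (lam j - w)\<^sup>2 * (v j $ lst)\<^sup>2"
      by (intro mult_strict_right_mono[OF far2]) simp
    then show "\<exists>j\<in>UNIV. 2 * b\<^sup>2 * (v j $ lst)\<^sup>2 < (lam j - w)\<^sup>2 * (v j $ lst)\<^sup>2"
      by blast
  qed simp
  also have "\<dots> = (norm u)\<^sup>2"
    using eigenbasis_norm[OF v, of u] coord_u[OF v] by (simp add: power_mult_distrib[symmetric])
  also have "\<dots> \<le> 2 * b\<^sup>2" by (rule norm_u)
  also have "\<dots> = (\<Sum>j\<in>UNIV. 2 * b\<^sup>2 * (v j $ lst)\<^sup>2)"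
    using sum_lst[OF v] by (simp add: sum_distrib_left[symmetric])
  finally show False by simp
qed

text \<open>\<open>Q\<close> maps \<open>v' j\<close> to a unit eigenvector of \<open>T\<close> for
  \<open>lam j\<close>, which is \<open>v j\<close> up to sign because the spectrum is simple; hence
  the absolute values. Pairing it with \<open>Tq\<close> gives the identity.\<close>

lemma transport:
  assumes v: "eigenbasis T lam v" and v': "eigenbasis (W0 T) lam v'" and "inj lam"
  shows "\<bar>v' j $ lst\<bar> * \<bar>lam j - w\<bar> = \<rho> * \<bar>v j $ lst\<bar>"
proof -
  define x where "x = Q *v v' j"
  have Tx: "T *v x = lam j *\<^sub>R x"
    using v' by (simp add: x_def Q_W0[symmetric] eigenbasis_def matrix_vector_mult_scaleR)
  have "v l \<bullet> x = 0" if "l \<noteq> j" for l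
  proof -
    have "lam l \<noteq> lam j" using \<open>inj lam\<close> that by (auto dest: injD)
    then show ?thesis using eigenbasis_inner_mult[OF v sym, of l x] by (simp add: Tx)
  qed
  then have px: "x \<bullet> y = (v j \<bullet> x) * (v j \<bullet> y)" for y
    by (subst eigenbasis_parseval[OF v]) (subst sum.remove[of UNIV j]; simp)
  have "x \<bullet> x = 1" using v' Q_isometry by (simp add: x_def eigenbasis_def)
  then have "\<bar>v j \<bullet> x\<bar> = 1" using px[of x] by (simp add: power2_eq_square flip: abs_square_eq_1)
  then have xe: "\<bar>x \<bullet> e\<bar> = \<bar>v j $ lst\<bar>" by (subst px) (simp add: abs_mult)
  have "(lam j - w) * (v' j $ lst) = (lam j - w) * (x \<bullet> q)"
    using Q_isometry[of "v' j" e] by (simp add: x_def q_def)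
  also have "\<dots> = (T *v x) \<bullet> q - w * (x \<bullet> q)" by (simp add: Tx algebra_simps)
  also have "\<dots> = \<rho> * (x \<bullet> e)"
    unfolding symmetric_mat_inner[OF sym] Tq by (simp add: inner_add_right)
  finally have "\<bar>lam j - w\<bar> * \<bar>v' j $ lst\<bar> = \<rho> * \<bar>x \<bullet> e\<bar>"
    using \<rho> by (metis abs_mult abs_of_pos)
  then show ?thesis by (simp only: xe mult.commute)
qed

text \<open>Two hops through the new last diagonal entry: from \<open>w\<close> to it by
  \<open>next_diag\<close>, from it to the new shift by \<open>shift_diag\<close>, each of length at
  most \<open>\<rho>\<close>.\<close>

lemma next_shift:
  assumes "W0 T \<in> Wdom lam"
  shows "\<bar>wshift (W0 T) - w\<bar> \<le> 2 * sqrt 2 * \<bar>b\<bar>"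
proof -
  interpret nxt: wilkinson_step lam "W0 T"
    by unfold_locales (use n2 assms in auto)
  have "\<bar>e \<bullet> q\<bar> \<le> 1" using S2_nonneg by (simp add: S2_def abs_square_le_1)
  then have "\<bar>W0 T$lst$lst - w\<bar> \<le> \<rho>"
    using next_diag \<rho> mult_left_mono[of "\<bar>e \<bullet> q\<bar>" 1 \<rho>] by (simp add: abs_mult)
  then show ?thesis using nxt.shift_diag next_sub_le_\<rho> \<rho>_le_b by linarith
qed

end

section \<open>Steps close to deflation\<close>

text \<open>\<open>g\<close> is a lower bound for the spectral gaps, \<open>i\<close> the eigenvalue
  next to the shift. The factor 24 leaves room for \<open>\<bar>a' - lam i\<bar> \<le> g / 4\<close>
  in the study of non-cubic steps.\<close>

locale near_deflation = wilkinson_step lam T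
  for lam :: "'n::{finite,wellorder} \<Rightarrow> real" and T +
  fixes v :: "'n::{finite,wellorder} \<Rightarrow> real^'n::{finite,wellorder}" and i :: 'n and g :: real
  assumes v: "eigenbasis T lam v"
    and g: "g > 0" and gap: "\<And>j l. j \<noteq> l \<Longrightarrow> g \<le> \<bar>lam j - lam l\<bar>"
    and near: "\<bar>lam i - w\<bar> \<le> sqrt 2 * \<bar>b\<bar>" and b_small: "24 * \<bar>b\<bar> \<le> g"
begin

lemma sqrt2_less: "sqrt 2 < 3 / 2"
  by (rule real_less_lsqrt) (auto simp: power2_eq_square)

lemma near_abs: "\<bar>lam i - w\<bar> \<le> 3 / 2 * \<bar>b\<bar>"
  using near sqrt2_less mult_right_mono[of "sqrt 2" "3/2" "\<bar>b\<bar>"] by simp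

lemma far: "j \<noteq> i \<Longrightarrow> g / 2 \<le> \<bar>lam j - w\<bar>"
  using gap[of j i] near_abs b_small by linarith

text \<open>\<open>e\<close> is almost an eigenvector: the coordinates of \<open>u\<close> are those
  of \<open>e\<close> times \<open>lam j - w\<close>, of modulus at least \<open>g / 2\<close> off
  \<open>i\<close>, while the squared norm of \<open>u\<close> is at most
  \<open>2 * b\<^sup>2\<close>.\<close>

lemma sum_others: "(\<Sum>j\<in>UNIV - {i}. (v j $ lst)\<^sup>2) \<le> 8 * b\<^sup>2 / g\<^sup>2"
proof -
  have "(g / 2)\<^sup>2 * (\<Sum>j\<in>UNIV - {i}. (v j $ lst)\<^sup>2) = (\<Sum>j\<in>UNIV - {i}. (g / 2 * v j $ lst)\<^sup>2)"
    by (simp add: sum_distrib_left power_mult_distrib power_divide)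
  also have "\<dots> \<le> (\<Sum>j\<in>UNIV - {i}. (v j \<bullet> u)\<^sup>2)"
  proof (rule sum_mono)
    fix j assume "j \<in> UNIV - {i}"
    then have "g / 2 * \<bar>v j $ lst\<bar> \<le> \<bar>lam j - w\<bar> * \<bar>v j $ lst\<bar>"
      using far by (intro mult_right_mono) auto
    then have "\<bar>g / 2 * v j $ lst\<bar> \<le> \<bar>v j \<bullet> u\<bar>"
      using g by (simp add: coord_u[OF v, symmetric] abs_mult)
    then show "(g / 2 * v j $ lst)\<^sup>2 \<le> (v j \<bullet> u)\<^sup>2" by (simp only: abs_le_square_iff)
  qed
  also have "\<dots> \<le> (norm u)\<^sup>2"
    unfolding eigenbasis_norm[OF v] by (rule sum_mono2) auto
  also have "\<dots> \<le> 2 * b\<^sup>2" by (rule norm_u)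
  finally show ?thesis using g by (simp add: field_simps power2_eq_square)
qed

text \<open>\<open>S2\<close> is the squared distance from \<open>e\<close> to the line through
  \<open>q\<close>, so any multiple of \<open>q\<close> gives an upper bound. With the multiple
  below, the coordinates off \<open>i\<close> at most double, whence 4 * 8 = 32.\<close>

lemma S2_small: "S2 \<le> 32 * b\<^sup>2 / g\<^sup>2"
proof -
  \<comment> \<open>This multiple of \<open>q\<close> cancels the component of $e_n$ along the eigenvector \<open>v i\<close>.\<close>
  define t d where "t = (lam i - w) / \<rho>" and "d = e - t *\<^sub>R q"
  have vd: "v j \<bullet> d = v j $ lst - t * (v j \<bullet> q)" for j
    by (simp add: d_def inner_diff_right)
  have di: "v i \<bullet> d = 0" using coord_q[OF v, of i] \<rho> by (simp add: vd t_def)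
  have dj: "(v j \<bullet> d)\<^sup>2 \<le> 4 * (v j $ lst)\<^sup>2" if "j \<noteq> i" for j
  proof -
    have "(lam j - w) * (v j \<bullet> d) = (lam j - w) * v j $ lst - t * ((lam j - w) * (v j \<bullet> q))"
      by (simp add: vd algebra_simps)
    also have "\<dots> = (lam j - lam i) * v j $ lst"
    proof -
      have "t * (\<rho> * v j $ lst) = (lam i - w) * v j $ lst" using \<rho> by (simp add: t_def)
      then show ?thesis unfolding coord_q[OF v] by (simp add: algebra_simps)
    qed
    finally have "\<bar>lam j - w\<bar> * \<bar>v j \<bullet> d\<bar> = \<bar>lam j - lam i\<bar> * \<bar>v j $ lst\<bar>"
      by (metis abs_mult)
    also have "\<dots> \<le> (2 * \<bar>lam j - w\<bar>) * \<bar>v j $ lst\<bar>"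
    proof (rule mult_right_mono)
      have "\<bar>lam i - w\<bar> \<le> \<bar>lam j - w\<bar>" using far[OF that] near_abs b_small by argo
      then show "\<bar>lam j - lam i\<bar> \<le> 2 * \<bar>lam j - w\<bar>" by argo
    qed simp
    finally have "\<bar>v j \<bullet> d\<bar> \<le> \<bar>2 * v j $ lst\<bar>"
      using lam_neq_shift[OF v, of j] by (simp add: abs_mult)
    then have "(v j \<bullet> d)\<^sup>2 \<le> (2 * v j $ lst)\<^sup>2" by (simp only: abs_le_square_iff)
    then show ?thesis by (simp add: power_mult_distrib)
  qed
  \<comment> \<open>Pythagoras for the parts of \<open>d\<close> orthogonal and parallel to
    \<open>q\<close>.\<close>
  have "S2 + (t - e \<bullet> q)\<^sup>2 = (norm d)\<^sup>2"
    using norm_q unfolding norm_eq_1 S2_def power2_norm_eq_inner d_def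
    by (simp add: inner_diff_left inner_diff_right power2_eq_square algebra_simps)
  then have "S2 \<le> (norm d)\<^sup>2" by (metis add_increasing2 zero_le_power2 le_add_same_cancel1)
  also have "\<dots> = (\<Sum>j\<in>UNIV - {i}. (v j \<bullet> d)\<^sup>2)"
    unfolding eigenbasis_norm[OF v] by (subst sum.remove[of UNIV i]) (simp_all add: di)
  also have "\<dots> \<le> (\<Sum>j\<in>UNIV - {i}. 4 * (v j $ lst)\<^sup>2)" using dj by (intro sum_mono) auto
  also have "\<dots> \<le> 4 * (8 * b\<^sup>2 / g\<^sup>2)"
    using sum_others by (simp add: sum_distrib_left[symmetric])
  finally show ?thesis by simp
qed

text \<open>Both \<open>\<rho>\<close> and \<open>sqrt S2\<close> are of order \<open>b\<close>; the
  constant is the square root of 2 * 32.\<close>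

lemma quadratic: "\<bar>b1\<bar> \<le> 8 / g * \<bar>b\<bar>\<^sup>2"
proof -
  have "b1\<^sup>2 \<le> (\<rho> * sqrt S2)\<^sup>2" using power_mono[OF next_sub_le, of 2] by simp
  also have "\<dots> = \<rho>\<^sup>2 * S2" using S2_nonneg by (simp add: power_mult_distrib)
  also have "\<dots> \<le> (sqrt 2 * \<bar>b\<bar>)\<^sup>2 * (32 * b\<^sup>2 / g\<^sup>2)"
    using \<rho> \<rho>_le_b S2_small S2_nonneg by (intro mult_mono power_mono) auto
  also have "\<dots> = (8 / g * \<bar>b\<bar>\<^sup>2)\<^sup>2"
    by (simp add: power_mult_distrib power_divide power2_eq_square)
  finally have "\<bar>b1\<bar> \<le> \<bar>8 / g * \<bar>b\<bar>\<^sup>2\<bar>" by (simp only: abs_le_square_iff)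
  then show ?thesis using g by (simp add: abs_mult)
qed

lemma cubic: "\<bar>b1\<bar> * \<bar>a - a'\<bar> \<le> 32 * norm r / g\<^sup>2 * \<bar>b\<bar> ^ 3"
proof -
  have "\<bar>b1\<bar> * \<bar>a - a'\<bar> \<le> \<bar>b\<bar> * norm r * (32 * b\<^sup>2 / g\<^sup>2)"
    using next_sub_gap mult_left_mono[OF S2_small, of "\<bar>b\<bar> * norm r"] by simp
  also have "\<dots> = 32 * norm r / g\<^sup>2 * \<bar>b\<bar> ^ 3"
    by (simp add: power3_eq_cube power2_eq_square)
  finally show ?thesis .
qed

end

section \<open>What a step with nearly equal last diagonal entries looks like\<close>

context near_deflation
begin

lemma diag_near: "\<bar>a - lam i\<bar> \<le> 5 / 2 * \<bar>b\<bar>"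
  using shift_diag near_abs by argo

lemma sum_pen: "(\<Sum>j\<in>UNIV. (v j $ pen)\<^sup>2) = 1"
  using eigenbasis_norm[OF v, of f] by simp

lemma b_square: "576 * b\<^sup>2 \<le> g\<^sup>2"
  using power_mono[OF b_small, of 2] by (simp add: power_mult_distrib)

text \<open>\<open>f\<close> is orthogonal to \<open>e\<close>, and \<open>e\<close> is almost
  \<open>v i\<close>; Cauchy-Schwarz over the other coordinates makes this quantitative.\<close>

lemma pen_near_small: "(v i $ pen)\<^sup>2 \<le> 16 * b\<^sup>2 / g\<^sup>2"
proof -
  have "8 * b\<^sup>2 \<le> 1 / 2 * g\<^sup>2" using b_square zero_le_power2[of b] by linarith
  then have "8 * b\<^sup>2 / g\<^sup>2 \<le> 1 / 2" using g by (simp add: divide_le_eq)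
  then have "(\<Sum>j\<in>UNIV - {i}. (v j $ lst)\<^sup>2) \<le> 1 / 2" using sum_others by linarith
  moreover have "(v i $ lst)\<^sup>2 + (\<Sum>j\<in>UNIV - {i}. (v j $ lst)\<^sup>2) = 1"
    using sum_lst[OF v] by (simp add: sum.remove[of UNIV i])
  ultimately have xi: "1 / 2 \<le> (v i $ lst)\<^sup>2" by linarith
  have "0 = (\<Sum>j\<in>UNIV. v j $ lst * v j $ pen)"
    using eigenbasis_parseval[OF v, of e f] by simp
  then have "v i $ lst * v i $ pen = - (\<Sum>j\<in>UNIV - {i}. v j $ lst * v j $ pen)"
    by (simp add: sum.remove[of UNIV i])
  then have "(v i $ lst)\<^sup>2 * (v i $ pen)\<^sup>2 = (\<Sum>j\<in>UNIV - {i}. v j $ lst * v j $ pen)\<^sup>2"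
    unfolding power_mult_distrib[symmetric] by simp
  also have "\<dots> \<le> (\<Sum>j\<in>UNIV - {i}. (v j $ lst)\<^sup>2) * (\<Sum>j\<in>UNIV - {i}. (v j $ pen)\<^sup>2)"
    by (rule Cauchy_Schwarz_ineq_sum)
  also have "\<dots> \<le> 8 * b\<^sup>2 / g\<^sup>2 * (\<Sum>j\<in>UNIV. (v j $ pen)\<^sup>2)"
    using sum_others by (intro mult_mono sum_mono2 sum_nonneg) auto
  also have "\<dots> = 8 * b\<^sup>2 / g\<^sup>2" by (simp add: sum_pen)
  finally have "(v i $ lst)\<^sup>2 * (v i $ pen)\<^sup>2 \<le> 8 * b\<^sup>2 / g\<^sup>2" .
  moreover have "1 / 2 * (v i $ pen)\<^sup>2 \<le> (v i $ lst)\<^sup>2 * (v i $ pen)\<^sup>2"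
    using xi by (intro mult_right_mono) auto
  ultimately show ?thesis by simp
qed

text \<open>The squares \<open>(v j $ pen)\<^sup>2\<close> are weights of total 1 with mean
  eigenvalue \<open>a'\<close>, which is close to \<open>lam i\<close>. The weight at
  \<open>i\<close> is tiny, so some other \<open>l\<close> is heavy; as \<open>lam l\<close> is far
  from the mean, a further index must balance it, and the weight at \<open>i\<close> is too small
  for that.\<close>

lemma two_large_components:
  fixes M :: real
  defines "N \<equiv> real CARD('n)"
  defines "\<eta> \<equiv> g / (16 * M * N\<^sup>2)"
  assumes M: "\<And>j. \<bar>lam j\<bar> \<le> M" "g \<le> M" and bad: "\<bar>a - a'\<bar> \<le> g / 8"
    and b_tiny: "16 * b\<^sup>2 / g\<^sup>2 < \<eta>"
  obtains j l where "j \<noteq> l" "j \<noteq> i" "l \<noteq> i" "\<eta> \<le> (v j $ pen)\<^sup>2" "\<eta> \<le> (v l $ pen)\<^sup>2"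
proof -
  have N: "N \<ge> 1" by (simp add: N_def Suc_le_eq)
  have a'i: "\<bar>a' - lam i\<bar> \<le> g / 4" using diag_near bad b_small by argo
  have far': "g / 2 \<le> \<bar>lam j - a'\<bar>" if "j \<noteq> i" for j
    using gap[OF that] a'i g by argo
  have upper: "\<bar>lam j - a'\<bar> \<le> 3 * M" for j
    using M(1)[of j] M(1)[of i] M(2) g a'i by argo
  have "\<eta> > 0" using g M(2) N by (simp add: \<eta>_def)
  have centered: "(\<Sum>j\<in>UNIV. (v j $ pen)\<^sup>2 * (lam j - a')) = 0"
  proof -
    have "a' = f \<bullet> (T *v f)" by (simp add: mult_axis_nth)
    also have "\<dots> = (\<Sum>j\<in>UNIV. (v j \<bullet> f) * (v j \<bullet> (T *v f)))"
      by (rule eigenbasis_parseval[OF v])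
    also have "\<dots> = (\<Sum>j\<in>UNIV. (v j $ pen)\<^sup>2 * lam j)"
      unfolding eigenbasis_inner_mult[OF v sym] by (simp add: power2_eq_square mult_ac)
    finally show ?thesis
      by (simp add: right_diff_distrib sum_subtractf sum_distrib_right[symmetric] sum_pen)
  qed
  have yi: "(v i $ pen)\<^sup>2 < \<eta>" using pen_near_small b_tiny by linarith
  \<comment> \<open>More than half of the total weight is spread over fewer than \<open>N\<close>
    indices.\<close>
  have "\<exists>l\<in>UNIV - {i}. 1 / (2 * N) \<le> (v l $ pen)\<^sup>2"
  proof (rule ccontr)
    assume "\<not> ?thesis"
    then have "(\<Sum>l\<in>UNIV - {i}. (v l $ pen)\<^sup>2) \<le> (\<Sum>l\<in>UNIV - {i}. 1 / (2 * N))"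
      by (intro sum_mono) (auto simp: not_le intro: less_imp_le)
    also have "\<dots> \<le> (\<Sum>l\<in>(UNIV::'n set). 1 / (2 * N))" using N by (intro sum_mono2) auto
    also have "\<dots> = 1 / 2" using N by (simp add: N_def)
    finally have "(\<Sum>l\<in>UNIV - {i}. (v l $ pen)\<^sup>2) \<le> 1 / 2" .
    moreover have "(v i $ pen)\<^sup>2 + (\<Sum>j\<in>UNIV - {i}. (v j $ pen)\<^sup>2) = 1"
      using sum_pen by (simp add: sum.remove[of UNIV i])
    moreover have "16 * b\<^sup>2 < 1 / 2 * g\<^sup>2"
      using b_square zero_less_power[OF g, of 2] by linarith
    then have "16 * b\<^sup>2 / g\<^sup>2 < 1 / 2" using g by (simp add: divide_less_eq)
    ultimately show False using pen_near_small by linarith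
  qed
  then obtain l where l: "l \<noteq> i" "1 / (2 * N) \<le> (v l $ pen)\<^sup>2" by blast
  have "\<exists>j\<in>UNIV - {l}. \<eta> \<le> (v j $ pen)\<^sup>2"
  proof (rule ccontr)
    assume "\<not> ?thesis"
    then have small: "(v j $ pen)\<^sup>2 * \<bar>lam j - a'\<bar> \<le> \<eta> * (3 * M)" if "j \<in> UNIV - {l}" for j
      using upper[of j] \<open>\<eta> > 0\<close> that by (intro mult_mono) (auto simp: not_le intro: less_imp_le)
    have "1 / (2 * N) * (g / 2) \<le> (v l $ pen)\<^sup>2 * \<bar>lam l - a'\<bar>"
      using l far'[of l] g by (intro mult_mono) auto
    also have "\<dots> = \<bar>\<Sum>j\<in>UNIV - {l}. (v j $ pen)\<^sup>2 * (lam j - a')\<bar>"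
      using centered by (simp add: sum.remove[of UNIV l] abs_mult add_eq_0_iff)
    also have "\<dots> \<le> (\<Sum>j\<in>UNIV - {l}. \<eta> * (3 * M))"
      by (rule order.trans[OF sum_abs]) (intro sum_mono, use small in \<open>simp add: abs_mult\<close>)
    also have "\<dots> \<le> (\<Sum>j\<in>(UNIV::'n set). \<eta> * (3 * M))"
      using \<open>\<eta> > 0\<close> g M(2) by (intro sum_mono2) auto
    also have "\<dots> = N * (\<eta> * (3 * M))" by (simp add: N_def)
    \<comment> \<open>The 16 in \<open>\<eta>\<close> makes this smaller than the lower bound
      \<open>g / (4 * N)\<close> at the start of the chain.\<close>
    also have "\<dots> = 3 * g / (16 * N)"
      using g M(2) N by (simp add: \<eta>_def power2_eq_square)
    finally show False using g N by (simp add: field_simps)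
  qed
  then obtain j where j: "j \<noteq> l" "\<eta> \<le> (v j $ pen)\<^sup>2" by blast
  have "g * 1 \<le> M * N" using g M(2) N by (intro mult_mono) auto
  also have "\<dots> \<le> 8 * (M * N)" using g M(2) N by simp
  finally have "\<eta> \<le> 1 / (2 * N)"
    using g M(2) N by (simp add: \<eta>_def field_simps power2_eq_square)
  then have "\<eta> \<le> (v l $ pen)\<^sup>2" using l by linarith
  moreover have "j \<noteq> i" using yi j by auto
  ultimately show thesis using that j l by blast
qed

text \<open>By \<open>coord_pen\<close> the last components are those at \<open>pen\<close> times
  \<open>b / (lam j - a)\<close>. In the ratio \<open>b\<close> cancels, and off \<open>i\<close>
  the denominators lie between \<open>g / 2\<close> and \<open>3 * M\<close>.\<close>

lemma comparable:
  fixes M \<eta> :: real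
  assumes M: "\<And>j. \<bar>lam j\<bar> \<le> M" "g \<le> M"
    and j: "j \<noteq> i" "\<eta> \<le> (v j $ pen)\<^sup>2" and l: "l \<noteq> i" "\<eta> \<le> (v l $ pen)\<^sup>2" and "\<eta> > 0"
  shows "v j $ lst \<noteq> 0" and "\<bar>v l $ lst\<bar> / \<bar>v j $ lst\<bar> \<le> 6 * M / (g * sqrt \<eta>)"
proof -
  have d: "g / 2 \<le> \<bar>lam j - a\<bar>" "\<bar>lam j - a\<bar> \<le> 3 * M" if "j \<noteq> i" for j
    using gap[OF that] diag_near b_small M(1)[of j] M(1)[of i] M(2) by argo+
  have b0: "\<bar>b\<bar> > 0" using b_nonzero by simp
  have x: "\<bar>b\<bar> * \<bar>v j $ pen\<bar> = \<bar>lam j - a\<bar> * \<bar>v j $ lst\<bar>" for j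
    using coord_pen[OF v, of j] by (metis abs_mult)
  have "sqrt \<eta> \<le> \<bar>v j $ pen\<bar>"
    using j(2) real_sqrt_le_mono by fastforce
  then have "\<bar>b\<bar> * sqrt \<eta> \<le> \<bar>lam j - a\<bar> * \<bar>v j $ lst\<bar>"
    unfolding x[symmetric] by (intro mult_left_mono) auto
  also have "\<dots> \<le> 3 * M * \<bar>v j $ lst\<bar>"
    using d(2)[OF j(1)] by (intro mult_right_mono) auto
  finally have lower: "\<bar>b\<bar> * sqrt \<eta> \<le> 3 * M * \<bar>v j $ lst\<bar>" .
  moreover have "0 < \<bar>b\<bar> * sqrt \<eta>" using b0 \<open>\<eta> > 0\<close> by simp
  ultimately show "v j $ lst \<noteq> 0" by auto
  have "(v l $ pen)\<^sup>2 \<le> (\<Sum>j\<in>UNIV. (v j $ pen)\<^sup>2)"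
    by (rule member_le_sum) auto
  then have "\<bar>v l $ pen\<bar> \<le> 1" by (simp add: sum_pen abs_square_le_1)
  then have "\<bar>lam l - a\<bar> * \<bar>v l $ lst\<bar> \<le> \<bar>b\<bar>"
    unfolding x[symmetric] using mult_left_mono[of "\<bar>v l $ pen\<bar>" 1 "\<bar>b\<bar>"] by simp
  moreover have "g / 2 * \<bar>v l $ lst\<bar> \<le> \<bar>lam l - a\<bar> * \<bar>v l $ lst\<bar>"
    using d(1)[OF l(1)] by (intro mult_right_mono) auto
  ultimately have "g / 2 * \<bar>v l $ lst\<bar> \<le> \<bar>b\<bar>" by linarith
  then have "(g / 2 * \<bar>v l $ lst\<bar>) * sqrt \<eta> \<le> \<bar>b\<bar> * sqrt \<eta>"
    using \<open>\<eta> > 0\<close> by (intro mult_right_mono) auto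
  with lower have "g * sqrt \<eta> * \<bar>v l $ lst\<bar> \<le> 6 * M * \<bar>v j $ lst\<bar>" by (simp add: mult_ac)
  then show "\<bar>v l $ lst\<bar> / \<bar>v j $ lst\<bar> \<le> 6 * M / (g * sqrt \<eta>)"
    using \<open>v j $ lst \<noteq> 0\<close> g \<open>\<eta> > 0\<close> by (simp add: divide_le_eq pos_le_divide_eq mult_ac)
qed

end

section \<open>Orbits\<close>

text \<open>From the first member of \<open>B\<close> to any later one, \<open>s\<close> falls at
  most from \<open>H\<close> to \<open>1 / H\<close>; more than \<open>L\<close> steps of decay
  would exceed this.\<close>

lemma contraction_window:
  fixes s :: "nat \<Rightarrow> real"
  assumes decay: "\<And>k m. k \<in> B \<Longrightarrow> m \<in> B \<Longrightarrow> k \<le> m \<Longrightarrow> s m \<le> c ^ (m - k) * s k"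
    and bounds: "\<And>k. k \<in> B \<Longrightarrow> 1 / H \<le> s k \<and> s k \<le> H"
    and c: "0 < c" "c < 1" and H: "H > 0" and L: "c ^ L * H\<^sup>2 < 1"
  shows "finite B \<and> card B \<le> L + 1"
proof (cases "B = {}")
  case False
  define k0 where "k0 = (LEAST k. k \<in> B)"
  have k0: "k0 \<in> B" using False unfolding k0_def by (metis LeastI ex_in_conv)
  have "B \<subseteq> {k0..k0 + L}"
  proof
    fix m assume m: "m \<in> B"
    then have km: "k0 \<le> m" unfolding k0_def by (rule Least_le)
    have "m - k0 \<le> L"
    proof (rule ccontr)
      assume "\<not> m - k0 \<le> L"
      then have "c ^ (m - k0) \<le> c ^ L" using c by (intro power_decreasing) auto
      have "1 / H \<le> c ^ (m - k0) * s k0" using decay[OF k0 m km] bounds[OF m] by linarith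
      also have "\<dots> \<le> c ^ L * H"
        using \<open>c ^ (m - k0) \<le> c ^ L\<close> bounds[OF k0] H c
        by (intro mult_mono) (auto intro: order.trans[of 0 "1 / H"])
      finally have "1 \<le> c ^ L * H * H" using H by (simp add: divide_le_eq)
      then show False using L by (simp add: power2_eq_square mult_ac)
    qed
    then show "m \<in> {k0..k0 + L}" using km by simp
  qed
  then have "finite B" "card B \<le> card {k0..k0 + L}"
    using finite_subset card_mono[of "{k0..k0 + L}" B] by auto
  then show ?thesis by simp
qed simp

text \<open>Here the step is a limit along \<open>Wdom lam\<close>, and the bound of the new entry
  by \<open>sqrt 2\<close> times the old one passes to the limit.\<close>

lemma Wstep_deflated:
  fixes T :: "real^'n::{finite,wellorder}^'n::{finite,wellorder}"
  assumes n2: "CARD('n) \<ge> 2" and T: "Wdefined lam T" "T$lst$pen = 0"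
  shows "Wstep lam T $ lst $ pen = 0"
proof -
  let ?F = "at T within Wdom lam"
  have "T \<notin> Wdom lam"
    using T(2) wilkinson_step.b_nonzero[of lam T] n2 by (auto simp: wilkinson_step_def)
  with T(1) obtain M where M: "(W0 \<longlongrightarrow> M) ?F" and nb: "?F \<noteq> bot"
    by (auto simp: Wdefined_def)
  have "Wstep lam T = M"
    using \<open>T \<notin> Wdom lam\<close> tendsto_Lim[OF nb M] by (simp add: Wstep_def)
  have *: "\<bar>W0 S $ lst $ pen\<bar> \<le> sqrt 2 * \<bar>S $ lst $ pen\<bar>" if "S \<in> Wdom lam" for S
  proof -
    interpret wilkinson_step lam S by unfold_locales (use n2 that in auto)
    show ?thesis using next_sub_le_\<rho> \<rho>_le_b by linarith
  qed
  have "((\<lambda>S. \<bar>W0 S $ lst $ pen\<bar>) \<longlongrightarrow> \<bar>M $ lst $ pen\<bar>) ?F"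
    by (intro tendsto_intros M)
  moreover have "((\<lambda>S. sqrt 2 * \<bar>S $ lst $ pen\<bar>) \<longlongrightarrow> sqrt 2 * \<bar>T $ lst $ pen\<bar>) ?F"
    by (intro tendsto_intros)
  moreover have "\<forall>\<^sub>F S in ?F. \<bar>W0 S $ lst $ pen\<bar> \<le> sqrt 2 * \<bar>S $ lst $ pen\<bar>"
    using * by (auto simp: eventually_at_filter)
  ultimately have "\<bar>M $ lst $ pen\<bar> \<le> sqrt 2 * \<bar>T $ lst $ pen\<bar>"
    using tendsto_le[OF nb] by blast
  then show ?thesis using T(2) \<open>Wstep lam T = M\<close> by simp
qed

lemma norm_mult_le_spectrum:
  assumes "eigenbasis T lam v" "symmetric_mat T" and M: "\<And>j. \<bar>lam j\<bar> \<le> M"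
  shows "norm (T *v x) \<le> M * norm x"
proof -
  have "M \<ge> 0" using M[of undefined] by linarith
  have "(norm (T *v x))\<^sup>2 = (\<Sum>i\<in>UNIV. (lam i)\<^sup>2 * (v i \<bullet> x)\<^sup>2)"
    unfolding eigenbasis_norm[OF assms(1)] eigenbasis_inner_mult[OF assms(1,2)]
    by (simp add: power_mult_distrib)
  also have "\<dots> \<le> (\<Sum>i\<in>UNIV. M\<^sup>2 * (v i \<bullet> x)\<^sup>2)"
    using M \<open>M \<ge> 0\<close> by (intro sum_mono mult_right_mono) (auto simp: abs_le_square_iff[symmetric])
  also have "\<dots> = (M * norm x)\<^sup>2"
    unfolding power_mult_distrib eigenbasis_norm[OF assms(1)] by (simp add: sum_distrib_left)
  finally show ?thesis using \<open>M \<ge> 0\<close> by (meson norm_ge_zero power2_le_imp_le mult_nonneg_nonneg)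
qed

text \<open>\<open>h\<close> quantifies AP-freeness: no two eigenvalues are nearly equidistant from
  a third. \<open>M\<close> bounds the spectrum and dominates \<open>g\<close> and
  \<open>h\<close>.\<close>

locale wilkinson_orbit =
  fixes lam :: "'n::{finite,wellorder} \<Rightarrow> real"
    and T :: "nat \<Rightarrow> real^'n::{finite,wellorder}^'n::{finite,wellorder}"
    and g h M :: real
  assumes n2: "CARD('n) \<ge> 2"
    and orbit: "\<And>k. Wdefined lam (T k)" "\<And>k. T (Suc k) = Wstep lam (T k)"
    and g: "g > 0" and gap: "\<And>j l. j \<noteq> l \<Longrightarrow> g \<le> \<bar>lam j - lam l\<bar>"
    and M: "\<And>j. \<bar>lam j\<bar> \<le> M" and gM: "g \<le> M"
    and h: "0 < h" "h \<le> M"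
    and AP_gap: "\<And>i j l. i \<noteq> j \<Longrightarrow> i \<noteq> l \<Longrightarrow> j \<noteq> l \<Longrightarrow> h \<le> \<bar>\<bar>lam j - lam i\<bar> - \<bar>lam l - lam i\<bar>\<bar>"
begin

abbreviation "\<beta> k \<equiv> T k $ lst $ pen"
abbreviation "\<omega> k \<equiv> wshift (T k)"

lemma inj_lam: "inj lam"
  using gap g by (fastforce intro: injI)

lemma TLam: "T k \<in> TLam lam"
  using orbit(1)[of k] by (auto simp: Wdefined_def Wdom_def)

text \<open>The bases are chosen independently for each \<open>k\<close>, so signs are arbitrary and
  only absolute values are compared between steps.\<close>

definition "V k = (SOME v. eigenbasis (T k) lam v)"

lemma V: "eigenbasis (T k) lam (V k)"
  using TLam_eigenbasis[OF TLam inj_lam, of k] unfolding V_def by (metis someI_ex)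

abbreviation "x j k \<equiv> V k j $ lst"

lemma b_zero: "\<beta> k = 0 \<Longrightarrow> \<beta> (Suc k) = 0"
  using Wstep_deflated[OF n2 orbit(1)] orbit(2) by simp

lemma b_zero_le:
  assumes "\<beta> m \<noteq> 0" "k \<le> m"
  shows "\<beta> k \<noteq> 0"
proof
  assume "\<beta> k = 0"
  from assms(2) this have "\<beta> m = 0" by (induction rule: dec_induct) (auto intro: b_zero)
  with assms(1) show False by simp
qed

lemma step:
  assumes "\<beta> k \<noteq> 0"
  shows "wilkinson_step lam (T k)" "W0 (T k) = T (Suc k)" "W0 (T k) \<in> TLam lam" "T k \<in> Wdom lam"
proof -
  show dom: "T k \<in> Wdom lam" using orbit(1)[of k] assms by (auto simp: Wdefined_def)
  then show "wilkinson_step lam (T k)" using n2 by unfold_locales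
  show "W0 (T k) = T (Suc k)" using orbit(2)[of k] dom by (simp add: Wstep_def)
  then show "W0 (T k) \<in> TLam lam" using TLam by simp
qed

lemma M_pos: "M > 0" using g gM by linarith

lemma residue_le: "norm (residue (T k)) \<le> M" and b_le: "\<bar>\<beta> k\<bar> \<le> M"
proof -
  note cols = TLam_columns[OF n2 TLam[of k]]
  have sym: "symmetric_mat (T k)" using TLam[of k] by (simp add: TLam_def)
  have Tf: "norm (T k *v axis pen 1) \<le> M"
    using norm_mult_le_spectrum[OF V sym M, of "axis pen 1"] by simp
  let ?r = "residue (T k)"
  have "norm ?r * norm ?r = ?r \<bullet> (T k *v axis pen 1)"
    unfolding cols(2) using cols(3,4) by (simp add: inner_add_right power2_norm_eq_inner flip: power2_eq_square)
  also have "\<dots> \<le> norm ?r * norm (T k *v axis pen 1)" by (rule norm_cauchy_schwarz)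
  finally show "norm ?r \<le> M" using Tf M_pos by (cases "?r = 0") auto
  show "\<bar>\<beta> k\<bar> \<le> M"
    using component_le_norm_cart[of "T k *v axis pen 1" lst] Tf by (simp add: mult_axis_nth)
qed

lemma potential: "(\<beta> k)\<^sup>2 * norm (residue (T k)) \<le> (sqrt 2 / 2) ^ k * M ^ 3"
proof (induction k)
  case 0
  have "(\<beta> 0)\<^sup>2 * norm (residue (T 0)) \<le> M\<^sup>2 * M"
    using residue_le[of 0] b_le[of 0] M_pos
    by (intro mult_mono) (auto simp: abs_le_square_iff[symmetric])
  then show ?case by (simp add: power3_eq_cube power2_eq_square)
next
  case (Suc k)
  show ?case
  proof (cases "\<beta> k = 0")
    case False
    have "(\<beta> (Suc k))\<^sup>2 * norm (residue (T (Suc k))) \<le> sqrt 2 / 2 * ((\<beta> k)\<^sup>2 * norm (residue (T k)))"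
      using wilkinson_step.next_potential[OF step(1,3)[OF False]] by (simp add: step[OF False])
    also have "\<dots> \<le> sqrt 2 / 2 * ((sqrt 2 / 2) ^ k * M ^ 3)"
      using Suc by (intro mult_left_mono) auto
    finally show ?thesis by (simp add: mult_ac)
  qed (use M_pos in \<open>simp add: b_zero\<close>)
qed

lemma b_cube_le: "\<bar>\<beta> (Suc k)\<bar> ^ 3 \<le> 2 * ((sqrt 2 / 2) ^ k * M ^ 3)"
proof (cases "\<beta> k = 0")
  case False
  then show ?thesis
    using wilkinson_step.next_cube[OF step(1)[OF False]] potential[of k] by (simp add: step(2))
qed (use M_pos in \<open>simp add: b_zero\<close>)

end

text \<open>From time \<open>K1\<close> on the corner entry is at most \<open>\<epsilon>\<close>.
  The three bounds on \<open>\<epsilon>\<close> serve, in order, \<open>near_deflation\<close>, the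
  distance of at most \<open>h / 4\<close> between shift and eigenvalue, and
  \<open>two_large_components\<close>.\<close>

locale deflating_orbit = wilkinson_orbit +
  fixes K1 :: nat and \<epsilon> \<eta> :: real
  assumes small: "\<And>k. K1 \<le> k \<Longrightarrow> \<bar>\<beta> k\<bar> \<le> \<epsilon>"
    and \<epsilon>: "24 * \<epsilon> \<le> g" "8 * \<epsilon> \<le> h" "16 * \<epsilon>\<^sup>2 / g\<^sup>2 < \<eta>"
    and \<eta>: "\<eta> = g / (16 * M * (real CARD('a))\<^sup>2)"
begin

lemma \<eta>_pos: "\<eta> > 0"
  using g M_pos by (simp add: \<eta>)

lemma near_exists:
  assumes "\<beta> k \<noteq> 0"
  shows "\<exists>i. \<bar>lam i - \<omega> k\<bar> \<le> sqrt 2 * \<bar>\<beta> k\<bar>"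
  using wilkinson_step.ex_near_shift[OF step(1)[OF assms] V] .

lemma near_deflationI:
  assumes "K1 \<le> k" "\<beta> k \<noteq> 0" "\<bar>lam i - \<omega> k\<bar> \<le> sqrt 2 * \<bar>\<beta> k\<bar>"
  shows "near_deflation lam (T k) (V k) i g"
proof -
  have "24 * \<bar>\<beta> k\<bar> \<le> g" using small[OF assms(1)] \<epsilon>(1) by linarith
  then show ?thesis
    by (intro near_deflation.intro near_deflation_axioms.intro step(1) V g gap assms)
qed

lemma quadratic:
  assumes "K1 \<le> k"
  shows "\<bar>\<beta> (Suc k)\<bar> \<le> 8 / g * \<bar>\<beta> k\<bar>\<^sup>2"
proof (cases "\<beta> k = 0")
  case False
  then obtain i where "near_deflation lam (T k) (V k) i g" using near_exists near_deflationI[OF assms] by blast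
  from near_deflation.quadratic[OF this] show ?thesis by (simp add: step(2)[OF False])
qed (use b_zero in simp)

text \<open>The eigenvalue about to be deflated, fixed at time \<open>K1\<close>. Should
  \<open>\<beta> K1\<close> be 0, all later entries are 0 and \<open>near\<close> claims
  nothing.\<close>

definition "i = (SOME i. \<bar>lam i - \<omega> K1\<bar> \<le> sqrt 2 * \<bar>\<beta> K1\<bar>)"

lemma near:
  assumes "K1 \<le> k" "\<beta> k \<noteq> 0"
  shows "\<bar>lam i - \<omega> k\<bar> \<le> sqrt 2 * \<bar>\<beta> k\<bar>"
  using assms
proof (induction k rule: dec_induct)
  case base
  then show ?case unfolding i_def by (rule someI_ex[OF near_exists])
next
  case (step k)
  have bk: "\<beta> k \<noteq> 0" using step.prems by (rule b_zero_le) simp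
  obtain i' where i': "\<bar>lam i' - \<omega> (Suc k)\<bar> \<le> sqrt 2 * \<bar>\<beta> (Suc k)\<bar>"
    using near_exists[OF step.prems] by blast
  have dist: "\<bar>\<omega> (Suc k) - \<omega> k\<bar> \<le> 2 * sqrt 2 * \<bar>\<beta> k\<bar>"
    using wilkinson_step.next_shift[OF wilkinson_orbit.step(1)[OF wilkinson_orbit_axioms bk]]
      wilkinson_orbit.step(2)[OF wilkinson_orbit_axioms bk]
      wilkinson_orbit.step(4)[OF wilkinson_orbit_axioms step.prems]
    by simp
  have "sqrt 2 < 3 / 2" by (rule real_less_lsqrt) (auto simp: power2_eq_square)
  then have s: "sqrt 2 * \<bar>\<beta> m\<bar> \<le> 3 / 2 * \<epsilon>" if "K1 \<le> m" for m
    using small[OF that] by (intro mult_mono) auto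
  \<comment> \<open>The three distances add up to at most \<open>6 * \<epsilon>\<close>, below the
    spectral gap, so the shift cannot switch eigenvalues.\<close>
  have "\<bar>lam i - lam i'\<bar> < g"
    using step.IH[OF bk] i' dist s[of k] s[of "Suc k"] step.hyps \<epsilon>(1) g by fastforce
  then have "i' = i" using gap[of i i'] by fastforce
  then show ?case using i' by simp
qed

text \<open>The two distances to the shift differ by at least \<open>h / 2\<close>, and the larger
  is at most \<open>3 * M\<close>; \<open>c\<close> bounds their quotient.\<close>

definition "c = 1 - h / (6 * M)"

lemma c: "0 < c" "c < 1"
  using h M_pos by (auto simp: c_def field_simps)

text \<open>A step multiplies the last component of the \<open>m\<close>-th eigenvector by $\rho/|\lambda_m - w|$, and $w$ is
  almost $\lambda_i$; AP-freeness keeps the two factors apart.\<close>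
lemma ratio_decay:
  assumes k: "K1 \<le> k" "\<beta> (Suc k) \<noteq> 0" and jl: "j \<noteq> i" "l \<noteq> i" "\<bar>lam l - lam i\<bar> < \<bar>lam j - lam i\<bar>"
    and xl: "x l k \<noteq> 0"
  shows "x l (Suc k) \<noteq> 0" "\<bar>x j (Suc k)\<bar> / \<bar>x l (Suc k)\<bar> \<le> c * (\<bar>x j k\<bar> / \<bar>x l k\<bar>)"
proof -
  have bk: "\<beta> k \<noteq> 0" using k(2) by (rule b_zero_le) simp
  interpret S: near_deflation lam "T k" "V k" i g
    by (rule near_deflationI[OF k(1) bk near[OF k(1) bk]])
  have tr: "\<bar>x m (Suc k)\<bar> * \<bar>lam m - \<omega> k\<bar> = S.\<rho> * \<bar>x m k\<bar>" for m
    using S.transport[OF V _ inj_lam, of "V (Suc k)" m] V[of "Suc k"] by (simp add: step(2)[OF bk])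
  have pos: "\<bar>lam m - \<omega> k\<bar> > 0" for m using S.lam_neq_shift[OF V, of m] by simp
  have "S.\<rho> > 0" by (rule S.\<rho>)
  have xm: "\<bar>x m (Suc k)\<bar> = S.\<rho> * \<bar>x m k\<bar> / \<bar>lam m - \<omega> k\<bar>" for m
    using tr[of m] pos[of m] by (simp add: eq_divide_eq)
  show "x l (Suc k) \<noteq> 0" using xm[of l] xl pos[of l] \<open>S.\<rho> > 0\<close> by auto
  have near: "\<bar>lam i - \<omega> k\<bar> \<le> h / 4"
    using S.near_abs small[OF k(1)] \<epsilon>(2) h by linarith
  have "h \<le> \<bar>lam j - lam i\<bar> - \<bar>lam l - lam i\<bar>" using AP_gap[of i j l] jl by auto
  \<comment> \<open>Replacing \<open>lam i\<close> by the shift costs \<open>h / 4\<close> in each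
    distance.\<close>
  then have d: "\<bar>lam l - \<omega> k\<bar> \<le> \<bar>lam j - \<omega> k\<bar> - h / 2" using near by argo
  have "\<bar>lam j - \<omega> k\<bar> \<le> 3 * M" using M[of j] M[of i] near h by argo
  then have "h / (6 * M) * \<bar>lam j - \<omega> k\<bar> \<le> h / (6 * M) * (3 * M)"
    using h M_pos by (intro mult_left_mono) auto
  then have "\<bar>lam l - \<omega> k\<bar> \<le> c * \<bar>lam j - \<omega> k\<bar>"
    using d M_pos by (simp add: c_def algebra_simps)
  then have q: "\<bar>lam l - \<omega> k\<bar> / \<bar>lam j - \<omega> k\<bar> \<le> c"
    using pos[of j] by (simp add: divide_le_eq)
  have "\<bar>x j (Suc k)\<bar> / \<bar>x l (Suc k)\<bar> = (\<bar>lam l - \<omega> k\<bar> / \<bar>lam j - \<omega> k\<bar>) * (\<bar>x j k\<bar> / \<bar>x l k\<bar>)"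
    unfolding xm using \<open>S.\<rho> > 0\<close> by simp
  also have "\<dots> \<le> c * (\<bar>x j k\<bar> / \<bar>x l k\<bar>)" using q by (rule mult_right_mono) simp
  finally show "\<bar>x j (Suc k)\<bar> / \<bar>x l (Suc k)\<bar> \<le> c * (\<bar>x j k\<bar> / \<bar>x l k\<bar>)" .
qed

lemma ratio_decay_power:
  assumes "K1 \<le> k" "k \<le> m" "\<beta> m \<noteq> 0" and jl: "j \<noteq> i" "l \<noteq> i" "\<bar>lam l - lam i\<bar> < \<bar>lam j - lam i\<bar>"
    and xl: "x l k \<noteq> 0"
  shows "x l m \<noteq> 0 \<and> \<bar>x j m\<bar> / \<bar>x l m\<bar> \<le> c ^ (m - k) * (\<bar>x j k\<bar> / \<bar>x l k\<bar>)"
  using assms(2,3)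
proof (induction m rule: dec_induct)
  case base
  then show ?case using xl by simp
next
  case (step m)
  have bm: "\<beta> m \<noteq> 0" using step.prems by (rule b_zero_le) simp
  note IH = step.IH[OF bm]
  have "K1 \<le> m" using assms(1) step.hyps by simp
  note rd = ratio_decay[OF this step.prems jl conjunct1[OF IH]]
  have "\<bar>x j (Suc m)\<bar> / \<bar>x l (Suc m)\<bar> \<le> c * (\<bar>x j m\<bar> / \<bar>x l m\<bar>)" by (rule rd(2))
  also have "\<dots> \<le> c * (c ^ (m - k) * (\<bar>x j k\<bar> / \<bar>x l k\<bar>))"
    using IH c by (intro mult_left_mono) auto
  also have "\<dots> = c ^ (Suc m - k) * (\<bar>x j k\<bar> / \<bar>x l k\<bar>)"
    using step.hyps by (simp add: Suc_diff_le)
  finally show ?case using rd(1) by simp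
qed

definition "H = 6 * M / (g * sqrt \<eta>)"

text \<open>The pair is oriented so that \<open>lam j\<close> is the farther from
  \<open>lam i\<close>: then the ratio of \<open>x j\<close> to \<open>x l\<close> is the decreasing
  one.\<close>

definition "comparable_set j l = {k. K1 \<le> k \<and> \<beta> k \<noteq> 0 \<and> j \<noteq> i \<and> l \<noteq> i \<and>
   \<bar>lam l - lam i\<bar> < \<bar>lam j - lam i\<bar> \<and> x j k \<noteq> 0 \<and> x l k \<noteq> 0 \<and>
   \<bar>x j k\<bar> / \<bar>x l k\<bar> \<le> H \<and> \<bar>x l k\<bar> / \<bar>x j k\<bar> \<le> H}"

lemma H_pos: "H > 0"
  using g M_pos \<eta>_pos by (simp add: H_def)

lemma card_comparable_set:
  assumes "c ^ L * H\<^sup>2 < 1"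
  shows "finite (comparable_set j l) \<and> card (comparable_set j l) \<le> L + 1"
proof (rule contraction_window[where s = "\<lambda>k. \<bar>x j k\<bar> / \<bar>x l k\<bar>" and c = c and H = H])
  fix k m assume "k \<in> comparable_set j l" "m \<in> comparable_set j l" "k \<le> m"
  then show "\<bar>x j m\<bar> / \<bar>x l m\<bar> \<le> c ^ (m - k) * (\<bar>x j k\<bar> / \<bar>x l k\<bar>)"
    using ratio_decay_power[of k m j l] by (simp add: comparable_set_def)
next
  fix k assume k: "k \<in> comparable_set j l"
  then have "\<bar>x l k\<bar> \<le> H * \<bar>x j k\<bar>" by (simp add: comparable_set_def divide_le_eq)
  then have "1 / H \<le> \<bar>x j k\<bar> / \<bar>x l k\<bar>"
    using k H_pos by (simp add: comparable_set_def field_simps)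
  then show "1 / H \<le> \<bar>x j k\<bar> / \<bar>x l k\<bar> \<and> \<bar>x j k\<bar> / \<bar>x l k\<bar> \<le> H"
    using k by (simp add: comparable_set_def)
qed (use c H_pos assms in auto)

text \<open>A non-cubic step forces nearly equal last diagonal entries, hence two large components
  of \<open>f\<close>, hence comparable last components of two eigenvectors.\<close>

lemma bad_comparable:
  assumes k: "K1 \<le> k" and C: "256 * M / g ^ 3 \<le> C" "0 < C"
    and bad: "C * \<bar>\<beta> k\<bar> ^ 3 < \<bar>\<beta> (Suc k)\<bar>"
  shows "\<exists>j l. k \<in> comparable_set j l"
proof -
  have bk: "\<beta> k \<noteq> 0" using bad b_zero[of k] by auto
  interpret S: near_deflation lam "T k" "V k" i g
    by (rule near_deflationI[OF k bk near[OF k bk]])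
  have "\<bar>S.a - S.a'\<bar> \<le> g / 8"
  proof (rule ccontr)
    assume "\<not> ?thesis"
    then have gt: "g / 8 \<le> \<bar>S.a - S.a'\<bar>" by simp
    \<comment> \<open>The constant 256 is the 32 of \<open>cubic\<close> times the 8 of the diagonal
      gap \<open>g / 8\<close>.\<close>
    have "32 * M / g\<^sup>2 \<le> C * (g / 8)"
      using C(1) g by (simp add: field_simps power2_eq_square power3_eq_cube)
    then have "32 * M / g\<^sup>2 * \<bar>\<beta> k\<bar> ^ 3 \<le> C * (g / 8) * \<bar>\<beta> k\<bar> ^ 3"
      by (rule mult_right_mono) simp
    also have "\<dots> = (C * \<bar>\<beta> k\<bar> ^ 3) * (g / 8)" by simp
    also have "\<dots> < \<bar>\<beta> (Suc k)\<bar> * (g / 8)" using bad g by (intro mult_strict_right_mono) auto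
    also have "\<dots> \<le> \<bar>\<beta> (Suc k)\<bar> * \<bar>S.a - S.a'\<bar>" using gt by (intro mult_left_mono) auto
    also have "\<dots> \<le> 32 * norm (residue (T k)) / g\<^sup>2 * \<bar>\<beta> k\<bar> ^ 3"
      using S.cubic by (simp add: step(2)[OF bk])
    also have "\<dots> \<le> 32 * M / g\<^sup>2 * \<bar>\<beta> k\<bar> ^ 3"
      using residue_le[of k] by (intro mult_right_mono divide_right_mono) auto
    finally show False by simp
  qed
  moreover have "16 * (\<beta> k)\<^sup>2 / g\<^sup>2 < \<eta>"
  proof -
    have "(\<beta> k)\<^sup>2 \<le> \<epsilon>\<^sup>2" using power_mono[OF small[OF k], of 2] by simp
    then have "16 * (\<beta> k)\<^sup>2 / g\<^sup>2 \<le> 16 * \<epsilon>\<^sup>2 / g\<^sup>2" by (intro divide_right_mono) auto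
    then show ?thesis using \<epsilon>(3) by linarith
  qed
  ultimately obtain j l where jl: "j \<noteq> l" "j \<noteq> i" "l \<noteq> i"
    "\<eta> \<le> (V k j $ pen)\<^sup>2" "\<eta> \<le> (V k l $ pen)\<^sup>2"
    using S.two_large_components[OF M gM] unfolding \<eta> by blast
  note c1 = S.comparable[OF M gM jl(2,4) jl(3,5) \<eta>_pos, folded H_def]
  note c2 = S.comparable[OF M gM jl(3,5) jl(2,4) \<eta>_pos, folded H_def]
  \<comment> \<open>AP-freeness decides which orientation of the pair applies.\<close>
  have "\<bar>lam l - lam i\<bar> \<noteq> \<bar>lam j - lam i\<bar>" using AP_gap[of i j l] jl h by auto
  then have "k \<in> comparable_set j l \<or> k \<in> comparable_set l j"
    using c1 c2 jl k bk by (auto simp: comparable_set_def neq_iff)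
  then show ?thesis by blast
qed

text \<open>Steps before \<open>K1\<close> are all counted; each later bad step falls into one of
  the sets attached to ordered pairs of indices, each with at most \<open>L + 1\<close>
  members.\<close>

lemma bad_count:
  assumes "256 * M / g ^ 3 \<le> C" "0 < C" and L: "c ^ L * H\<^sup>2 < 1"
  defines "B \<equiv> {k. k > 0 \<and> \<bar>\<beta> (Suc k)\<bar> > C * \<bar>\<beta> k\<bar> ^ 3}"
  shows "finite B" "card B \<le> K1 + CARD('a)\<^sup>2 * (L + 1)"
proof -
  let ?U = "\<Union>(j, l)\<in>UNIV. comparable_set j l"
  have sub: "B \<subseteq> {..<K1} \<union> ?U"
  proof
    fix k assume "k \<in> B"
    then have "C * \<bar>\<beta> k\<bar> ^ 3 < \<bar>\<beta> (Suc k)\<bar>" by (simp add: B_def)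
    then have "\<exists>j l. k \<in> comparable_set j l" if "K1 \<le> k"
      using bad_comparable[OF that assms(1,2)] by blast
    then show "k \<in> {..<K1} \<union> ?U" by (cases "K1 \<le> k") auto
  qed
  have finU: "finite ?U" using card_comparable_set[OF L] by auto
  show "finite B" using finite_subset[OF sub] finU by simp
  have "card ?U \<le> (\<Sum>p\<in>(UNIV :: ('a \<times> 'a) set). card (case p of (j, l) \<Rightarrow> comparable_set j l))"
    by (rule card_UN_le) simp
  also have "\<dots> \<le> (\<Sum>p\<in>(UNIV :: ('a \<times> 'a) set). L + 1)"
    using card_comparable_set[OF L] by (intro sum_mono) auto
  also have "\<dots> = CARD('a)\<^sup>2 * (L + 1)" by (simp add: power2_eq_square)
  finally have "card ({..<K1} \<union> ?U) \<le> K1 + CARD('a)\<^sup>2 * (L + 1)"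
    using card_Un_le[of "{..<K1}" ?U] by simp
  moreover have "card B \<le> card ({..<K1} \<union> ?U)"
    by (rule card_mono[OF _ sub]) (simp only: finite_Un finite_lessThan finU simp_thms)
  ultimately show "card B \<le> K1 + CARD('a)\<^sup>2 * (L + 1)" by (rule order.trans[rotated])
qed

end

section \<open>Constants depending on the spectrum only, and the conclusion\<close>

lemma finite_positive_lower_bound:
  fixes S :: "real set"
  assumes "finite S" "\<And>s. s \<in> S \<Longrightarrow> s > 0"
  obtains m where "m > 0" "\<And>s. s \<in> S \<Longrightarrow> m \<le> s"
  \<comment> \<open>The extra 1 covers the empty set, which occurs for triples of distinct indices
    when n = 2.\<close>
  using that[of "Min (insert 1 S)"] assms by auto

theorem theorem3p4:
  fixes lam :: "'n::{finite,wellorder} \<Rightarrow> real"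
  assumes n2: "CARD('n) \<ge> 2"
    and incr: "strict_mono lam"
    and apfree: "AP_free lam"
  shows "\<exists>C>0. \<exists>K>(0::real). \<forall>T :: nat \<Rightarrow> real^'n::{finite,wellorder}^'n::{finite,wellorder}.
           (T 0 \<in> TLam lam \<and> (\<forall>k. Wdefined lam (T k) \<and> T (Suc k) = Wstep lam (T k))) \<longrightarrow>
           ((\<forall>k. real k > K \<longrightarrow>
                 \<bar>T (Suc k) $ lst $ pen\<bar> < 1 / C \<and>
                 \<bar>T (Suc k) $ lst $ pen\<bar> \<le> C * \<bar>T k $ lst $ pen\<bar> ^ 2) \<and>
            finite {k. k > 0 \<and> \<bar>T (Suc k) $ lst $ pen\<bar> > C * \<bar>T k $ lst $ pen\<bar> ^ 3} \<and>
            real (card {k. k > 0 \<and> \<bar>T (Suc k) $ lst $ pen\<bar> > C * \<bar>T k $ lst $ pen\<bar> ^ 3}) \<le> K)"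
proof -
  have inj: "lam j \<noteq> lam l" if "j \<noteq> l" for j l
    using that incr by (meson strict_mono_eq)
  have "finite ((\<lambda>(j, l). \<bar>lam j - lam l\<bar>) ` {(j, l). j \<noteq> l})" by simp
  then obtain g where g: "g > 0" and gap: "\<And>j l. j \<noteq> l \<Longrightarrow> g \<le> \<bar>lam j - lam l\<bar>"
    by (rule finite_positive_lower_bound) (use inj in auto)
  have sep: "\<bar>lam j - lam i\<bar> \<noteq> \<bar>lam l - lam i\<bar>" if "i \<noteq> j" "i \<noteq> l" "j \<noteq> l" for i j l
  proof
    assume "\<bar>lam j - lam i\<bar> = \<bar>lam l - lam i\<bar>"
    then have "lam i = (lam j + lam l) / 2" using inj[OF that(3)] by (auto simp: abs_eq_iff)
    then show False using apfree that unfolding AP_free_def by blast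
  qed
  have "finite ((\<lambda>(i, j, l). \<bar>\<bar>lam j - lam i\<bar> - \<bar>lam l - lam i\<bar>\<bar>) ` {(i, j, l). i \<noteq> j \<and> i \<noteq> l \<and> j \<noteq> l})"
    by simp
  then obtain h where h: "h > 0" and h_le:
    "\<And>s. s \<in> (\<lambda>(i, j, l). \<bar>\<bar>lam j - lam i\<bar> - \<bar>lam l - lam i\<bar>\<bar>) ` {(i, j, l). i \<noteq> j \<and> i \<noteq> l \<and> j \<noteq> l} \<Longrightarrow> h \<le> s"
    by (rule finite_positive_lower_bound) (use sep in auto)
  have AP_gap: "h \<le> \<bar>\<bar>lam j - lam i\<bar> - \<bar>lam l - lam i\<bar>\<bar>" if "i \<noteq> j" "i \<noteq> l" "j \<noteq> l" for i j l
    by (rule h_le, rule image_eqI[of _ _ "(i, j, l)"]) (use that in auto)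
  define M where "M = (\<Sum>j\<in>UNIV. \<bar>lam j\<bar>) + g + h"
  have sum_nonneg': "0 \<le> (\<Sum>j\<in>UNIV. \<bar>lam j\<bar>)" by (simp add: sum_nonneg)
  have M: "\<bar>lam j\<bar> \<le> M" for j
    using member_le_sum[of j UNIV "\<lambda>j. \<bar>lam j\<bar>"] g h by (simp add: M_def)
  have gM: "g \<le> M" and hM: "h \<le> M" using sum_nonneg' g h by (auto simp: M_def)
  have Mpos: "M > 0" using g gM by linarith
  define \<eta> where "\<eta> = g / (16 * M * (real CARD('n))\<^sup>2)"
  have \<eta>: "\<eta> > 0" using g Mpos by (simp add: \<eta>_def)
  \<comment> \<open>The first summand serves quadratic convergence, the second the cubic estimate
    away from equal diagonal entries.\<close>
  define C where "C = 8 / g + 256 * M / g ^ 3 + 1"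
  have "8 / g > 0" "256 * M / g ^ 3 > 0" using g Mpos by simp_all
  then have C: "8 / g \<le> C" "256 * M / g ^ 3 \<le> C" "C > 0"
    unfolding C_def by linarith+
  \<comment> \<open>One threshold per demand on \<open>\<epsilon>\<close>; the third gives the
    strict bound by \<open>1 / C\<close>, the fourth the condition involving
    \<open>\<eta>\<close>.\<close>
  define E where "E = {g / 24, h / 8, 1 / (2 * C), g * sqrt \<eta> / 8}"
  have "g * sqrt \<eta> / 8 > 0" "1 / (2 * C) > 0" using g \<eta> C(3) by simp_all
  then have "s > 0" if "s \<in> E" for s
    using that g h unfolding E_def by (elim insertE) (simp_all del: eq_divide_eq_numeral1)
  then obtain \<epsilon> where \<epsilon>0: "\<epsilon> > 0" and \<epsilon>_le: "\<And>s. s \<in> E \<Longrightarrow> \<epsilon> \<le> s"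
    using finite_positive_lower_bound[of E] by (auto simp: E_def)
  have \<epsilon>: "\<epsilon> \<le> g / 24" "\<epsilon> \<le> h / 8" "\<epsilon> \<le> 1 / (2 * C)" "\<epsilon> \<le> g * sqrt \<eta> / 8"
    by (rule \<epsilon>_le, simp add: E_def)+
  have "\<epsilon>\<^sup>2 \<le> (g * sqrt \<eta> / 8)\<^sup>2" using \<epsilon> \<epsilon>0 by (intro power_mono) auto
  also have "\<dots> = g\<^sup>2 * \<eta> / 64" using \<eta> by (simp add: power_mult_distrib power_divide)
  finally have "16 * \<epsilon>\<^sup>2 / g\<^sup>2 \<le> \<eta> / 4" using g by (simp add: divide_le_eq mult_ac)
  then have \<epsilon>\<eta>: "16 * \<epsilon>\<^sup>2 / g\<^sup>2 < \<eta>" using \<eta> by linarith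
  define c0 H0 where "c0 = 1 - h / (6 * M)" and "H0 = 6 * M / (g * sqrt \<eta>)"
  have "0 < c0" "c0 < 1" using h hM Mpos by (auto simp: c0_def field_simps)
  moreover have H: "H0 > 0" using g Mpos \<eta> by (simp add: H0_def)
  ultimately obtain L where "c0 ^ L < 1 / H0\<^sup>2"
    using real_arch_pow_inv[of "1 / H0\<^sup>2" c0] by auto
  then have L: "c0 ^ L * H0\<^sup>2 < 1" using H by (simp add: less_divide_eq)
  have s2: "sqrt 2 / 2 < 1" using real_less_lsqrt[of 2 2] by simp
  obtain K0 where K0: "(sqrt 2 / 2) ^ K0 < \<epsilon> ^ 3 / (2 * M ^ 3)"
    using real_arch_pow_inv[OF _ s2, of "\<epsilon> ^ 3 / (2 * M ^ 3)"] \<epsilon>0 Mpos by auto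
  \<comment> \<open>The successor appears because \<open>b_cube_le\<close> bounds the entry one step
    after the potential. \<open>K\<close> is fixed before the orbit is, so it is uniform in
    \<open>T 0\<close>.\<close>
  define K where "K = Suc K0 + (CARD('n))\<^sup>2 * (L + 1)"
  show ?thesis
  proof (rule exI[of _ C], rule conjI[OF C(3)], rule exI[of _ "real K"], intro conjI allI impI)
    have "0 < K" by (simp add: K_def)
    then show "0 < real K" by simp
  next
    fix T :: "nat \<Rightarrow> real^'n::{finite,wellorder}^'n::{finite,wellorder}"
    assume T: "T 0 \<in> TLam lam \<and> (\<forall>k. Wdefined lam (T k) \<and> T (Suc k) = Wstep lam (T k))"
    interpret orb: wilkinson_orbit lam T g h M
      by unfold_locales (use n2 T g gap M gM h hM AP_gap in auto)
    have small: "\<bar>T k $ lst $ pen\<bar> \<le> \<epsilon>" if "Suc K0 \<le> k" for k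
    proof -
      obtain m where m: "k = Suc m" "K0 \<le> m" using \<open>Suc K0 \<le> k\<close> by (cases k) auto
      have "(sqrt 2 / 2) ^ m \<le> (sqrt 2 / 2) ^ K0" using s2 m by (intro power_decreasing) auto
      then have "(sqrt 2 / 2) ^ m * (2 * M ^ 3) \<le> (sqrt 2 / 2) ^ K0 * (2 * M ^ 3)"
        using Mpos by (intro mult_right_mono) auto
      also have "\<dots> \<le> \<epsilon> ^ 3" using K0 Mpos by (simp add: pos_less_divide_eq)
      finally have "(sqrt 2 / 2) ^ m * (2 * M ^ 3) \<le> \<epsilon> ^ 3" .
      then have "\<bar>T k $ lst $ pen\<bar> ^ 3 \<le> \<epsilon> ^ 3"
        using orb.b_cube_le[of m] m(1) by (simp add: mult_ac)
      then show ?thesis using \<epsilon>0 by (meson less_imp_le power_le_imp_le_base power_mono_iff abs_ge_zero zero_less_numeral)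
    qed
    interpret defl: deflating_orbit lam T g h M "Suc K0" \<epsilon> \<eta>
      by unfold_locales (use small \<epsilon> \<epsilon>\<eta> in \<open>auto simp: \<eta>_def\<close>)
    have L': "defl.c ^ L * defl.H\<^sup>2 < 1"
      using L by (simp only: defl.c_def defl.H_def c0_def H0_def)
    note cnt = defl.bad_count[OF C(2,3) L']
    show "finite {k. k > 0 \<and> \<bar>T (Suc k) $ lst $ pen\<bar> > C * \<bar>T k $ lst $ pen\<bar> ^ 3}"
      by (rule cnt(1))
    show "real (card {k. k > 0 \<and> \<bar>T (Suc k) $ lst $ pen\<bar> > C * \<bar>T k $ lst $ pen\<bar> ^ 3}) \<le> real K"
      using cnt(2) unfolding K_def of_nat_le_iff .
    fix k assume "real K < real k"
    then have "K < k" by simp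
    then have k: "Suc K0 \<le> k" by (simp add: K_def)
    have "\<epsilon> \<le> 1 / (2 * C)" using \<epsilon> by simp
    also have "\<dots> < 1 / C" using C(3) by (simp add: field_simps)
    finally show "\<bar>T (Suc k) $ lst $ pen\<bar> < 1 / C" using small[of "Suc k"] k by simp
    have "8 / g * \<bar>T k $ lst $ pen\<bar>\<^sup>2 \<le> C * \<bar>T k $ lst $ pen\<bar>\<^sup>2"
      using C(1) by (intro mult_right_mono) auto
    then show "\<bar>T (Suc k) $ lst $ pen\<bar> \<le> C * \<bar>T k $ lst $ pen\<bar>\<^sup>2"
      using defl.quadratic[OF k] by linarith
  qed
qed

end
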